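(* For Lebesgue-almost every triangle $\Delta$ (in the space of triangles up to similarity, parametrized by two of its angles $(\alpha,\beta)$ ranging over $\{\alpha>0,\beta>0,\alpha+\beta<\pi\}$ with Lebesgue measure), for every vertex $v$ of $\Delta$ and every $\epsilon>0$, $$\liminf_{n\to\infty} P_n(v)\,e^{-n^{\sqrt{3}-1+\epsilon}}<\infty.$$
   Context: Consider the billiard in a triangle $\Delta$. A generalized diagonal is a billiard orbit segment that starts at a vertex of $\Delta$ and ends at a vertex of $\Delta$; its length is its number of reflections. For a vertex $v$ of $\Delta$, $P_n(v)$ denotes the number of generalized diagonals of length at most $n$ emanating from $v$. *)

theory Defs
  imports "HOL-Analysis.Analysis"
begin

text \<open>Triangle with angles alpha at vertex 0 and beta at vertex 1, side from 0 to 1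
  of length 1, in the complex plane. The third vertex is given by the law of sines.\<close>
definition tri_C :: "real \<Rightarrow> real \<Rightarrow> complex" where
  "tri_C \<alpha> \<beta> = complex_of_real (sin \<beta> / sin (\<alpha> + \<beta>)) * cis \<alpha>"

definition tri_verts :: "real \<Rightarrow> real \<Rightarrow> complex set" where
  "tri_verts \<alpha> \<beta> = {0, 1, tri_C \<alpha> \<beta>}"

definition refl_dir :: "complex \<Rightarrow> complex \<Rightarrow> complex" where
  "refl_dir w d = (w ^ 2 / complex_of_real ((norm w) ^ 2)) * cnj d"

text \<open>A generalized diagonal of the billiard in the triangle with vertex set V, given by
  its list of break points [p0, p1, ..., pk, p(k+1)]: p0 and p(k+1) are vertices,
  p1..pk are reflection points in the relative interiors of sides, every open segment
  between consecutive points runs through the interior of the triangle, and at each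
  reflection point the outgoing direction is the mirror image of the incoming direction
  in the side. Its length (number of reflections) is  length ps - 2.\<close>
definition is_gen_diag :: "complex set \<Rightarrow> complex list \<Rightarrow> bool" where
  "is_gen_diag V ps \<longleftrightarrow>
     2 \<le> length ps \<and> hd ps \<in> V \<and> last ps \<in> V \<and>
     (\<forall>i. i + 1 < length ps \<longrightarrow>
          ps ! i \<noteq> ps ! (i + 1) \<and>
          open_segment (ps ! i) (ps ! (i + 1)) \<subseteq> interior (convex hull V)) \<and>
     (\<forall>i. 0 < i \<and> i + 1 < length ps \<longrightarrow>
          (\<exists>a\<in>V. \<exists>b\<in>V. a \<noteq> b \<and> ps ! i \<in> open_segment a b \<and>
             (\<exists>c::real. c > 0 \<and>
                ps ! (i + 1) - ps ! i = complex_of_real c * refl_dir (b - a) (ps ! i - ps ! (i - 1)))))"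

definition P_count :: "complex set \<Rightarrow> complex \<Rightarrow> nat \<Rightarrow> nat" where
  "P_count V v n = card {ps. is_gen_diag V ps \<and> hd ps = v \<and> length ps \<le> n + 2}"

end

theory Submission
  imports Defs "HOL-Real_Asymp.Real_Asymp" "HOL-Computational_Algebra.Fundamental_Theorem_Algebra"
begin

text \<open>
Unfold the billiard from the vertex. The directions whose trajectories hit the same sides form a beam (an open
cone), and generalized diagonals correspond to unfolded vertices that lie inside the beam arriving at them and
split it.

Within a window of \<open>m\<close> reflections the unfolded vertices are, up to a motion and the common factor
\<open>2 \<i> sin (\<alpha> + \<beta>)\<close>, Laurent polynomials in \<open>cis \<alpha>\<close> and \<open>cis \<beta>\<close> with integer coefficients and of degree \<open>O(m)\<close>.
There are exponentially many of them, so by Borel-Cantelli, for almost every triangle, three such vertices span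
an area that is either zero or at least \<open>exp (- O(m^2))\<close>.
Hence a beam that is thinner than this is split within the window by collinear vertices only. A beam cannot pass
two consecutive ones on opposite sides and be split by a third one on the same line, so a thin beam
has only \<open>O(m)\<close> descendants. At each level there are at most \<open>exp (O(m^2))\<close> beams that are not thin, because beams at the same level are
disjoint.

For \<open>n = m^3\<close> this gives \<open>P_n(v) \<le> exp (O(m^2 ln m))\<close>, that is, the exponent \<open>2/3\<close> up to a logarithm,
and \<open>2/3 < sqrt 3 - 1\<close>.
\<close>

section \<open>Lower bounds for trigonometric polynomials\<close>

text \<open>The area gap has to hold for exponentially many polynomials at once. For the exceptional
  sets to be summable, the roots are avoided only by a distance \<open>r = exp (- O(m))\<close>, and
  a polynomial of degree \<open>O(m)\<close> then stays above a power \<open>r ^ O(m)\<close>; this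
  is where the square in \<open>exp (- O(m^2))\<close> comes from. Used for all \<open>n\<close>
  reflections at once, such a gap would be worse than the trivial bound \<open>2 ^ n\<close>, so it
  is used only inside windows of \<open>m\<close> reflections. That works at any depth because a
  motion carries the original triangle to the copy where the window starts, and motions preserve
  areas up to sign. The alternative of area zero has to stay, since the polynomial of a triple may
  vanish identically; this is why collinear vertices need a geometric argument of their own. The
  windows contribute a factor \<open>(2 * m + 2) ^ (n div m)\<close>, the beams that are not thin a
  factor \<open>exp (O(m^2))\<close>. Up to a logarithm the exponents balance at
  \<open>n = m ^ 3\<close>, and for a liminf it is enough to bound the count along the
  cubes.\<close>

lemma small_prod_mset_imp:
  fixes r :: real
  assumes "prod_mset A < r ^ size A" "\<forall>x\<in>#A. 0 \<le> x" "0 \<le> r"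
  shows "\<exists>x\<in>#A. x < r"
proof (rule ccontr)
  assume "\<not> ?thesis"
  then have "\<forall>x\<in>#A. r \<le> x" by force
  then have "r ^ size A \<le> prod_mset A"
    using \<open>0 \<le> r\<close>
  proof (induction A)
    case (add x A)
    then have "r * r ^ size A \<le> x * prod_mset A"
      by (intro mult_mono) (auto intro: order_trans)
    then show ?case by simp
  qed auto
  with assms show False by simp
qed

lemma norm_prod_mset_image:
  "norm (prod_mset (image_mset f A)) = prod_mset (image_mset (\<lambda>x. norm (f x :: complex)) A)"
  by (induction A) (auto simp: norm_mult)

text \<open>Factor over the roots: the modulus is the leading coefficient, which is at least
  \<open>\<eta>\<close>, times the product of the distances to at most \<open>n\<close> roots, so
  one distance must be below \<open>r\<close>. The bound on all nonzero coefficients is what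
  controls the leading one, whatever the true degree is.\<close>

lemma small_poly_imp_near_root:
  fixes c :: "nat \<Rightarrow> complex"
  assumes \<eta>: "0 < \<eta>" "\<And>i. i \<le> n \<Longrightarrow> c i = 0 \<or> \<eta> \<le> norm (c i)"
    and nz: "\<exists>i\<le>n. c i \<noteq> 0" and r: "0 < r" "r \<le> 1"
  shows "\<exists>Z. finite Z \<and> card Z \<le> n \<and>
     (\<forall>y. norm (\<Sum>i\<le>n. c i * y ^ i) < \<eta> * r ^ n \<longrightarrow> (\<exists>z\<in>Z. norm (y - z) < r))"
proof -
  define p where "p = (\<Sum>i\<le>n. monom (c i) i)"
  have co: "coeff p i = (if i \<le> n then c i else 0)" for i
    unfolding p_def by (simp add: coeff_sum)
  have ev: "poly p y = (\<Sum>i\<le>n. c i * y ^ i)" for y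
    unfolding p_def by (simp add: poly_sum poly_monom)
  have pnz: "p \<noteq> 0"
    using nz co by (metis coeff_0)
  have deg: "degree p \<le> n"
    by (rule degree_le) (simp add: co)
  have lc: "\<eta> \<le> norm (lead_coeff p)"
    using \<eta>(2)[OF deg] pnz deg co[of "degree p"] leading_coeff_0_iff[of p] by auto
  obtain A where A: "size A = degree p" "p = smult (lead_coeff p) (\<Prod>x\<in>#A. [:-x, 1:])"
    using alg_closed_imp_factorization[OF pnz] by blast
  have near: "\<exists>z\<in>set_mset A. norm (y - z) < r"
    if *: "norm (\<Sum>i\<le>n. c i * y ^ i) < \<eta> * r ^ n" for y
  proof -
    let ?N = "image_mset (\<lambda>x. norm (y - x)) A"
    have "poly p y = lead_coeff p * (\<Prod>x\<in>#A. y - x)"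
      by (subst A(2)) (simp add: poly_prod_mset image_mset.compositionality o_def)
    then have "norm (lead_coeff p) * prod_mset ?N < \<eta> * r ^ n"
      using * ev[of y] norm_prod_mset_image[of "\<lambda>x. y - x" A] by (simp add: norm_mult)
    moreover have "0 \<le> prod_mset ?N"
      by (metis norm_ge_zero norm_prod_mset_image)
    then have "\<eta> * prod_mset ?N \<le> norm (lead_coeff p) * prod_mset ?N"
      using lc by (rule mult_right_mono[rotated])
    ultimately have "\<eta> * prod_mset ?N < \<eta> * r ^ n" by linarith
    then have "prod_mset ?N < r ^ n" using \<eta>(1) by simp
    also have "\<dots> \<le> r ^ size ?N"
      using A(1) deg r by (intro power_decreasing) auto
    finally have "\<exists>x\<in>#?N. x < r"
      using r by (intro small_prod_mset_imp) auto
    then show ?thesis by auto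
  qed
  moreover have "card (set_mset A) \<le> n"
    using size_mset_mono[OF mset_set_set_mset_msubset[of A]] A(1) deg by simp
  ultimately show ?thesis
    by (intro exI[of _ "set_mset A"]) auto
qed

lemma abs_le_pi_half_sin:
  assumes "0 \<le> x" "x \<le> pi / 2"
  shows "x \<le> pi / 2 * sin x"
proof -
  have cv: "concave_on {0..pi} sin"
    by (rule f''_le0_imp_concave[where f' = cos and f'' = "\<lambda>x. - sin x"])
       (auto intro!: derivative_eq_intros sin_ge_zero)
  have "sin ((1 - 2 * x / pi) *\<^sub>R 0 + (2 * x / pi) *\<^sub>R (pi / 2))
        \<ge> (1 - 2 * x / pi) * sin 0 + (2 * x / pi) * sin (pi / 2)"
    using assms by (intro concave_onD[OF cv]) (auto simp: field_simps)
  then have "2 * x / pi \<le> sin x" by simp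
  then show ?thesis by (simp add: field_simps)
qed

lemma norm_cis_diff: "norm (cis x - cis y) = 2 * \<bar>sin ((x - y) / 2)\<bar>"
proof -
  have "(norm (cis x - cis y))\<^sup>2 = (cos x - cos y)\<^sup>2 + (sin x - sin y)\<^sup>2"
    by (simp add: cmod_power2)
  also have "\<dots> = 2 - 2 * cos (x - y)"
    using sin_cos_squared_add[of x] sin_cos_squared_add[of y]
    by (simp add: cos_diff power2_eq_square algebra_simps)
  also have "\<dots> = (2 * sin ((x - y) / 2))\<^sup>2"
  proof -
    have "cos (2 * ((x - y) / 2)) = 1 - 2 * (sin ((x - y) / 2))\<^sup>2"
      by (rule cos_double_sin)
    moreover have "2 * ((x - y) / 2) = x - y" by simp
    ultimately have "cos (x - y) = 1 - 2 * (sin ((x - y) / 2))\<^sup>2" by (simp only:)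
    then show ?thesis by (simp add: power_mult_distrib)
  qed
  finally have "norm (cis x - cis y) = \<bar>2 * sin ((x - y) / 2)\<bar>"
    by (simp only: power2_eq_iff_nonneg[symmetric] norm_ge_zero abs_ge_zero power2_abs)
  then show ?thesis by (simp add: abs_mult)
qed

text \<open>Arc against chord: half the angle lies in \<open>{0..pi/2}\<close>, where Jordan's
  inequality \<open>abs_le_pi_half_sin\<close> applies.\<close>

lemma dist_le_norm_cis_diff:
  assumes "x \<in> {0..pi}" "y \<in> {0..pi}"
  shows "\<bar>x - y\<bar> \<le> pi / 2 * norm (cis x - cis y)"
proof -
  have "\<bar>x - y\<bar> / 2 \<le> pi / 2 * sin (\<bar>x - y\<bar> / 2)"
    using assms by (intro abs_le_pi_half_sin) auto
  moreover have "sin (\<bar>x - y\<bar> / 2) \<le> \<bar>sin ((x - y) / 2)\<bar>"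
  proof (cases "x \<le> y")
    case True
    then have "\<bar>x - y\<bar> / 2 = - ((x - y) / 2)" by (simp add: field_simps)
    then show ?thesis by (simp only: sin_minus abs_ge_minus_self)
  qed auto
  then have "pi / 2 * sin (\<bar>x - y\<bar> / 2) \<le> pi / 2 * \<bar>sin ((x - y) / 2)\<bar>"
    by (intro mult_left_mono) auto
  ultimately have "\<bar>x - y\<bar> / 2 \<le> pi / 2 * \<bar>sin ((x - y) / 2)\<bar>"
    by (rule order_trans)
  then show ?thesis
    unfolding norm_cis_diff by simp
qed

text \<open>The centre \<open>a\<close> is any member of the set. Two members have chord at most
  \<open>2 * r\<close>, hence angles at distance at most \<open>pi * r\<close>.\<close>

lemma cis_near_subset_interval:
  "\<exists>a. {x \<in> {0..pi}. norm (cis x - z) < r} \<subseteq> {a - pi * r..a + pi * r}"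
proof (cases "\<exists>a\<in>{0..pi}. norm (cis a - z) < r")
  case True
  then obtain a where a: "a \<in> {0..pi}" "norm (cis a - z) < r" by auto
  have "x \<in> {a - pi * r..a + pi * r}" if x: "x \<in> {0..pi}" "norm (cis x - z) < r" for x
  proof -
    have "norm (cis x - cis a) \<le> 2 * r"
      using norm_triangle_ineq4[of "cis x - z" "cis a - z"] a x by simp
    then have "pi / 2 * norm (cis x - cis a) \<le> pi / 2 * (2 * r)"
      by (intro mult_left_mono) auto
    then have "\<bar>x - a\<bar> \<le> pi * r"
      using dist_le_norm_cis_diff[OF x(1) a(1)] by linarith
    then show ?thesis by (auto simp: abs_le_iff)
  qed
  then show ?thesis by blast
qed auto

lemma small_trig_poly_cover:
  fixes c :: "nat \<Rightarrow> complex"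
  assumes "0 < \<eta>" "\<And>i. i \<le> n \<Longrightarrow> c i = 0 \<or> \<eta> \<le> norm (c i)"
    and "\<exists>i\<le>n. c i \<noteq> 0" and r: "0 < r" "r \<le> 1"
  shows "\<exists>A \<in> sets lborel. emeasure lborel A \<le> ennreal (real n * (2 * pi * r)) \<and>
     {x \<in> {0..pi}. norm (\<Sum>i\<le>n. c i * cis x ^ i) < \<eta> * r ^ n} \<subseteq> A"
proof -
  obtain Z where Z: "finite Z" "card Z \<le> n"
     "\<And>y. norm (\<Sum>i\<le>n. c i * y ^ i) < \<eta> * r ^ n \<Longrightarrow> (\<exists>z\<in>Z. norm (y - z) < r)"
    using small_poly_imp_near_root[OF assms] by blast
  obtain a where a: "\<And>z. {x \<in> {0..pi}. norm (cis x - z) < r} \<subseteq> {a z - pi * r..a z + pi * r}"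
    using cis_near_subset_interval[of _ r] by metis
  let ?A = "\<Union>z\<in>Z. {a z - pi * r..a z + pi * r}"
  have "emeasure lborel ?A \<le> (\<Sum>z\<in>Z. emeasure lborel {a z - pi * r..a z + pi * r})"
    using Z(1) by (intro emeasure_subadditive_finite) auto
  also have "\<dots> = of_nat (card Z) * ennreal (2 * pi * r)"
    using r by (simp add: mult.assoc)
  also have "\<dots> \<le> of_nat n * ennreal (2 * pi * r)"
    using Z(2) by (intro mult_right_mono) auto
  also have "\<dots> = ennreal (real n * (2 * pi * r))"
    using r by (simp add: ennreal_mult ennreal_of_nat_eq_real_of_nat)
  finally have "emeasure lborel ?A \<le> ennreal (real n * (2 * pi * r))" .
  moreover have "{x \<in> {0..pi}. norm (\<Sum>i\<le>n. c i * cis x ^ i) < \<eta> * r ^ n} \<subseteq> ?A"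
    using Z(3) a by blast
  moreover have "?A \<in> sets lborel"
    using Z(1) by auto
  ultimately show ?thesis by blast
qed

text \<open>Borel-Cantelli for the sets where some polynomial of the family is small without being
  identically zero. The coefficient bound is required only from \<open>M\<close> on, because in the
  second application below the coefficients depend on a fixed first angle and are controlled only
  for large \<open>m\<close>.\<close>

lemma AE_trig_poly_lower_bound:
  fixes c :: "nat \<Rightarrow> 'i \<Rightarrow> nat \<Rightarrow> complex" and \<eta> r :: "nat \<Rightarrow> real"
  assumes fin: "\<And>m. finite (I m)" and \<eta>: "\<And>m. 0 < \<eta> m"
    and c: "\<And>m \<iota> i. M \<le> m \<Longrightarrow> \<iota> \<in> I m \<Longrightarrow> i \<le> n m \<Longrightarrow> c m \<iota> i = 0 \<or> \<eta> m \<le> norm (c m \<iota> i)"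
    and r: "\<And>m. 0 < r m" "\<And>m. r m \<le> 1"
    and sm: "summable (\<lambda>m. real (card (I m)) * (real (n m) * (2 * pi * r m)))"
  shows "AE x in lborel. x \<in> {0..pi} \<longrightarrow> (\<forall>\<^sub>F m in sequentially. \<forall>\<iota>\<in>I m.
      (\<forall>i\<le>n m. c m \<iota> i = 0) \<or> \<eta> m * r m ^ n m \<le> norm (\<Sum>i\<le>n m. c m \<iota> i * cis x ^ i))"
proof -
  let ?bad = "\<lambda>m \<iota>. {x \<in> {0..pi}. norm (\<Sum>i\<le>n m. c m \<iota> i * cis x ^ i) < \<eta> m * r m ^ n m}"
  let ?P = "\<lambda>m \<iota>. M \<le> m \<and> \<iota> \<in> I m \<and> (\<exists>i\<le>n m. c m \<iota> i \<noteq> 0)"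
  \<comment> \<open>The guard \<open>?P\<close> makes a covering set available for every pair of
    indices (the empty set where it fails), so that the sets can be chosen by one total
    function.\<close>
  let ?Q = "\<lambda>m \<iota> A. A \<in> sets lborel \<and> emeasure lborel A \<le> ennreal (real (n m) * (2 * pi * r m)) \<and>
      (?P m \<iota> \<longrightarrow> ?bad m \<iota> \<subseteq> A)"
  have ex: "\<exists>A. ?Q m \<iota> A" for m \<iota>
  proof (cases "?P m \<iota>")
    case True
    then have "\<exists>A \<in> sets lborel. emeasure lborel A \<le> ennreal (real (n m) * (2 * pi * r m)) \<and>
        ?bad m \<iota> \<subseteq> A"
      by (intro small_trig_poly_cover c \<eta> r) auto
    then show ?thesis by (elim bexE) (intro exI conjI, auto)
  qed (auto intro!: exI[of _ "{}"])
  define A where "A m \<iota> = (SOME A. ?Q m \<iota> A)" for m \<iota>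
  have Q: "?Q m \<iota> (A m \<iota>)" for m \<iota>
    unfolding A_def by (rule someI_ex[OF ex])
  have A: "A m \<iota> \<in> sets lborel" "emeasure lborel (A m \<iota>) \<le> ennreal (real (n m) * (2 * pi * r m))"
      "?P m \<iota> \<Longrightarrow> ?bad m \<iota> \<subseteq> A m \<iota>" for m \<iota>
    using Q by blast+
  define B where "B m = (\<Union>\<iota>\<in>I m. A m \<iota>)" for m
  let ?b = "\<lambda>m. real (card (I m)) * (real (n m) * (2 * pi * r m))"
  have Bs: "B m \<in> sets lborel" for m
    unfolding B_def using fin A(1) by blast
  have bpos: "0 \<le> ?b m" for m
    using r(1)[of m] by simp
  have Be: "emeasure lborel (B m) \<le> ennreal (?b m)" for m
  proof -
    have "emeasure lborel (B m) \<le> (\<Sum>\<iota>\<in>I m. emeasure lborel (A m \<iota>))"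
      unfolding B_def using A(1) by (intro emeasure_subadditive_finite[OF fin]) auto
    also have "\<dots> \<le> (\<Sum>\<iota>\<in>I m. ennreal (real (n m) * (2 * pi * r m)))"
      by (intro sum_mono A(2))
    also have "\<dots> = ennreal (?b m)"
      using r(1)[of m] by (simp add: ennreal_of_nat_eq_real_of_nat flip: ennreal_mult)
    finally show ?thesis .
  qed
  have "measure lborel (B m) \<le> ?b m" for m
    unfolding measure_def using Be bpos by (simp add: enn2real_leI)
  then have "summable (\<lambda>m. measure lborel (B m))"
    by (intro summable_comparison_test'[OF sm, of 0]) auto
  then have "AE x in lborel. \<forall>\<^sub>F m in sequentially. x \<in> space lborel - B m"
    using Bs order.strict_trans1[OF Be ennreal_less_top]
    by (intro borel_cantelli_AE1) (simp_all add: infinity_ennreal_def)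
  then show ?thesis
  proof eventually_elim
    case (elim x)
    show ?case
    proof
      assume x: "x \<in> {0..pi}"
      show "\<forall>\<^sub>F m in sequentially. \<forall>\<iota>\<in>I m.
        (\<forall>i\<le>n m. c m \<iota> i = 0) \<or> \<eta> m * r m ^ n m \<le> norm (\<Sum>i\<le>n m. c m \<iota> i * cis x ^ i)"
        using elim eventually_ge_at_top[of M]
      proof eventually_elim
        case (elim m)
        show ?case
        proof (rule ballI, rule ccontr)
          fix \<iota>
          assume \<iota>: "\<iota> \<in> I m"
            "\<not> ((\<forall>i\<le>n m. c m \<iota> i = 0) \<or> \<eta> m * r m ^ n m \<le> norm (\<Sum>i\<le>n m. c m \<iota> i * cis x ^ i))"
          then have "x \<in> ?bad m \<iota>" "?P m \<iota>"
            using x elim by auto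
          then have "x \<in> A m \<iota>" using A(3) by blast
          then show False
            using elim \<iota>(1) unfolding B_def by blast
        qed
      qed
    qed
  qed
qed

section \<open>Integer Laurent polynomials in two angles\<close>

inductive laurent :: "nat \<Rightarrow> (real \<Rightarrow> real \<Rightarrow> complex) \<Rightarrow> bool" for d where
  laurent_monom: "\<lbrakk>\<bar>j\<bar> \<le> int d; \<bar>k\<bar> \<le> int d\<rbrakk> \<Longrightarrow> laurent d (\<lambda>a b. cis (of_int j * a + of_int k * b))"
| laurent_uminus: "laurent d f \<Longrightarrow> laurent d (\<lambda>a b. - f a b)"
| laurent_add: "\<lbrakk>laurent d f; laurent d g\<rbrakk> \<Longrightarrow> laurent d (\<lambda>a b. f a b + g a b)"

lemma laurent_diff:
  "\<lbrakk>laurent d f; laurent d g\<rbrakk> \<Longrightarrow> laurent d (\<lambda>a b. f a b - g a b)"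
  using laurent_add[OF _ laurent_uminus] by fastforce

lemma laurent_zero: "laurent d (\<lambda>a b. 0)"
  using laurent_diff[OF laurent_monom[of 0 d 0] laurent_monom[of 0 d 0]] by simp

lemma laurent_le:
  assumes "laurent d f" "d \<le> e"
  shows "laurent e f"
  using assms(1) by induction (use assms(2) in \<open>auto intro: laurent.intros\<close>)

lemma laurent_cnj:
  assumes "laurent d f"
  shows "laurent d (\<lambda>a b. cnj (f a b))"
  using assms
proof induction
  case (laurent_monom j k)
  then have "laurent d (\<lambda>a b. cis (of_int (- j) * a + of_int (- k) * b))"
    by (intro laurent.laurent_monom) auto
  then show ?case by (simp add: cis_cnj)
qed (auto intro: laurent.intros)

lemma laurent_cis_mult:
  assumes "laurent d f" "\<bar>j\<bar> \<le> int e" "\<bar>k\<bar> \<le> int e"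
  shows "laurent (d + e) (\<lambda>a b. cis (of_int j * a + of_int k * b) * f a b)"
  using assms(1)
proof induction
  case (laurent_monom j' k')
  then have "laurent (d + e) (\<lambda>a b. cis (of_int (j + j') * a + of_int (k + k') * b))"
    using assms(2,3) by (intro laurent.laurent_monom) auto
  then show ?case by (simp add: cis_mult algebra_simps)
qed (auto intro: laurent.intros simp: ring_distribs)

lemma laurent_mult:
  assumes "laurent e g" "laurent d f"
  shows "laurent (d + e) (\<lambda>a b. g a b * f a b)"
  using assms(1)
proof induction
  case (laurent_monom j k)
  then show ?case using laurent_cis_mult[OF assms(2)] by blast
qed (auto intro: laurent.intros simp: ring_distribs)

lemma laurent_continuous_on:
  assumes "laurent d f"
  shows "continuous_on UNIV (\<lambda>x. f (fst x) (snd x))"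
  using assms by induction (auto intro!: continuous_intros)

text \<open>The factor \<open>cis (real d * a + real d * b)\<close> has modulus 1 and shifts all
  exponents into \<open>{0..2*d}\<close>, so the modulus of \<open>f\<close> is that of an ordinary
  polynomial with integer coefficients.\<close>

lemma laurent_coeffs:
  assumes "laurent d f"
  shows "\<exists>c::nat \<Rightarrow> nat \<Rightarrow> int. \<forall>a b. f a b * cis (real d * a + real d * b) =
    (\<Sum>j\<le>2*d. (\<Sum>i\<le>2*d. of_int (c j i) * cis a ^ i) * cis b ^ j)"
  using assms
proof induction
  case (laurent_monom j k)
  let ?p = "nat (j + int d)" and ?q = "nat (k + int d)"
  have pq: "?p \<le> 2 * d" "?q \<le> 2 * d" and eq: "real_of_int j + real d = real ?p" "real_of_int k + real d = real ?q"
    using laurent_monom by auto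
  have "cis (real_of_int j * a + real_of_int k * b) * cis (real d * a + real d * b)
      = cis ((real_of_int j + real d) * a + (real_of_int k + real d) * b)" for a b
    by (simp add: cis_mult algebra_simps)
  also have "cis ((real_of_int j + real d) * a + (real_of_int k + real d) * b) = cis a ^ ?p * cis b ^ ?q" for a b
    unfolding eq by (simp add: Complex.DeMoivre cis_mult)
  also have "cis a ^ ?p * cis b ^ ?q =
     (\<Sum>j\<le>2*d. (\<Sum>i\<le>2*d. of_int (if i = ?p \<and> j = ?q then 1 else 0) * cis a ^ i) * cis b ^ j)" for a b
  proof -
    have "(\<Sum>i\<le>2*d. of_int (if i = ?p \<and> j = ?q then 1 else 0) * cis a ^ i) * cis b ^ j
        = (if ?q = j then cis a ^ ?p * cis b ^ j else 0)" for j
    proof (cases "?q = j")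
      case True
      then have "(\<Sum>i\<le>2*d. of_int (if i = ?p \<and> j = ?q then 1 else 0) * cis a ^ i)
        = (\<Sum>i\<le>2*d. if ?p = i then cis a ^ i else 0)"
        by (intro sum.cong) auto
      then show ?thesis using pq True by simp
    qed auto
    then show ?thesis using pq by simp
  qed
  finally show ?case by (intro exI[of _ "\<lambda>j i. if i = ?p \<and> j = ?q then 1 else 0"] allI)
next
  case (laurent_uminus f)
  then obtain c where c: "\<And>a b. f a b * cis (real d * a + real d * b) =
    (\<Sum>j\<le>2*d. (\<Sum>i\<le>2*d. of_int (c j i) * cis a ^ i) * cis b ^ j)" by blast
  show ?case
    by (intro exI[of _ "\<lambda>j i. - c j i"] allI) (simp add: c sum_negf)
next
  case (laurent_add f g)
  then obtain c c' where c: "\<And>a b. f a b * cis (real d * a + real d * b) =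
    (\<Sum>j\<le>2*d. (\<Sum>i\<le>2*d. of_int (c j i) * cis a ^ i) * cis b ^ j)"
    "\<And>a b. g a b * cis (real d * a + real d * b) =
    (\<Sum>j\<le>2*d. (\<Sum>i\<le>2*d. of_int (c' j i) * cis a ^ i) * cis b ^ j)" by blast
  show ?case
    by (intro exI[of _ "\<lambda>j i. c j i + c' j i"] allI) (simp add: c ring_distribs sum.distrib)
qed

text \<open>Two rounds of the one-variable bound. Nonzero integers have modulus at least 1, so for
  almost every \<open>a\<close> each coefficient of the polynomial in \<open>cis b\<close> is zero
  or at least \<open>r ^ (2 * d)\<close>. With this as the new \<open>\<eta>\<close>, the second
  round loses another \<open>r ^ (2 * d)\<close>. The factor \<open>2 * d + 1\<close> in the
  summability condition counts the coefficient polynomials of the first round.\<close>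

lemma AE_laurent_lower_bound:
  fixes F :: "nat \<Rightarrow> (real \<Rightarrow> real \<Rightarrow> complex) set" and r :: "nat \<Rightarrow> real"
  assumes fin: "\<And>m. finite (F m)" and lau: "\<And>m f. f \<in> F m \<Longrightarrow> laurent (d m) f"
    and r: "\<And>m. 0 < r m" "\<And>m. r m \<le> 1"
    and sm: "summable (\<lambda>m. real (card (F m)) * (real (2 * d m + 1) * (real (2 * d m) * (2 * pi * r m))))"
  shows "AE x in lborel. fst x \<in> {0..pi} \<and> snd x \<in> {0..pi} \<longrightarrow> (\<forall>\<^sub>F m in sequentially.
      \<forall>f\<in>F m. f (fst x) (snd x) = 0 \<or> r m ^ (4 * d m) \<le> norm (f (fst x) (snd x)))"
    (is "AE x in lborel. ?G x")
proof -
  let ?co = "\<lambda>m f (c::nat \<Rightarrow> nat \<Rightarrow> int). \<forall>a b. f a b * cis (real (d m) * a + real (d m) * b) =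
    (\<Sum>j\<le>2*d m. (\<Sum>i\<le>2*d m. of_int (c j i) * cis a ^ i) * cis b ^ j)"
  define c where "c m f = (SOME c. ?co m f c)" for m f
  have c: "?co m f (c m f)" if "f \<in> F m" for m f
    unfolding c_def by (rule someI_ex[OF laurent_coeffs[OF lau[OF that]]])
  define q where "q m f a j = (\<Sum>i\<le>2*d m. of_int (c m f j i) * cis a ^ i)" for m f a j
  have norm_f: "norm (f a b) = norm (\<Sum>j\<le>2*d m. q m f a j * cis b ^ j)" if "f \<in> F m" for f m a b
  proof -
    have "norm (f a b) = norm (f a b * cis (real (d m) * a + real (d m) * b))"
      by (simp add: norm_mult)
    then show ?thesis using c[OF that] unfolding q_def by simp
  qed
  have "AE a in lborel. a \<in> {0..pi} \<longrightarrow> (\<forall>\<^sub>F m in sequentially. \<forall>\<iota>\<in>F m \<times> {..2*d m}.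
      (\<forall>i\<le>2*d m. (\<lambda>m \<iota> i. of_int (c m (fst \<iota>) (snd \<iota>) i) :: complex) m \<iota> i = 0) \<or>
      1 * r m ^ (2 * d m) \<le> norm (\<Sum>i\<le>2*d m. (\<lambda>m \<iota> i. of_int (c m (fst \<iota>) (snd \<iota>) i)) m \<iota> i * cis a ^ i))"
  proof (rule AE_trig_poly_lower_bound[where \<eta> = "\<lambda>_. 1" and M = 0])
    show "summable (\<lambda>m. real (card (F m \<times> {..2 * d m})) * (real (2 * d m) * (2 * pi * r m)))"
      using sm by (simp add: card_cartesian_product algebra_simps)
    show "(of_int (c m (fst \<iota>) (snd \<iota>) i) :: complex) = 0 \<or> 1 \<le> norm (of_int (c m (fst \<iota>) (snd \<iota>) i) :: complex)" for m \<iota> i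
      by (cases "c m (fst \<iota>) (snd \<iota>) i = 0") (auto simp: norm_of_int simp flip: of_int_abs)
  qed (use fin r in auto)
  then have ae1: "AE a in lborel. a \<in> {0..pi} \<longrightarrow> (\<forall>\<^sub>F m in sequentially. \<forall>f\<in>F m. \<forall>j\<le>2*d m.
      q m f a j = 0 \<or> r m ^ (2 * d m) \<le> norm (q m f a j))"
  proof eventually_elim
    case (elim a)
    show ?case
    proof
      assume "a \<in> {0..pi}"
      with elim have "\<forall>\<^sub>F m in sequentially. \<forall>\<iota>\<in>F m \<times> {..2*d m}.
      (\<forall>i\<le>2*d m. (of_int (c m (fst \<iota>) (snd \<iota>) i) :: complex) = 0) \<or>
      1 * r m ^ (2 * d m) \<le> norm (\<Sum>i\<le>2*d m. of_int (c m (fst \<iota>) (snd \<iota>) i) * cis a ^ i)"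
        by blast
      then show "\<forall>\<^sub>F m in sequentially. \<forall>f\<in>F m. \<forall>j\<le>2*d m.
        q m f a j = 0 \<or> r m ^ (2 * d m) \<le> norm (q m f a j)"
      proof (rule eventually_mono, intro ballI allI impI)
        fix m f j
        assume *: "\<forall>\<iota>\<in>F m \<times> {..2*d m}.
          (\<forall>i\<le>2*d m. (of_int (c m (fst \<iota>) (snd \<iota>) i) :: complex) = 0) \<or>
          1 * r m ^ (2 * d m) \<le> norm (\<Sum>i\<le>2*d m. of_int (c m (fst \<iota>) (snd \<iota>) i) * cis a ^ i)"
          and "f \<in> F m" "j \<le> 2 * d m"
        then have "(f, j) \<in> F m \<times> {..2*d m}" by simp
        from bspec[OF * this] show "q m f a j = 0 \<or> r m ^ (2 * d m) \<le> norm (q m f a j)"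
          unfolding q_def by auto
      qed
    qed
  qed
  have sm2: "summable (\<lambda>m. real (card (F m)) * (real (2 * d m) * (2 * pi * r m)))"
  proof (rule summable_comparison_test'[OF sm, of 0])
    fix m
    let ?x = "real (2 * d m) * (2 * pi * r m)"
    have "0 \<le> ?x" using r(1)[of m] by simp
    then have "?x \<le> real (2 * d m + 1) * ?x"
      using mult_right_mono[of 1 "real (2 * d m + 1)" ?x] by simp
    then have "real (card (F m)) * ?x \<le> real (card (F m)) * (real (2 * d m + 1) * ?x)"
      by (rule mult_left_mono) simp
    with \<open>0 \<le> ?x\<close> show "norm (real (card (F m)) * ?x) \<le> real (card (F m)) * (real (2 * d m + 1) * ?x)"
      by (simp only: real_norm_def abs_of_nonneg mult_nonneg_nonneg of_nat_0_le_iff)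
  qed
  have ae: "AE a in lborel. AE b in lborel. ?G (a, b)"
    using ae1
  proof eventually_elim
    case (elim a)
    show ?case
    proof (cases "a \<in> {0..pi}")
      case True
      with elim obtain M where M: "\<And>m f j. \<lbrakk>M \<le> m; f \<in> F m; j \<le> 2 * d m\<rbrakk> \<Longrightarrow>
        q m f a j = 0 \<or> r m ^ (2 * d m) \<le> norm (q m f a j)"
        unfolding eventually_sequentially by blast
      have "AE b in lborel. b \<in> {0..pi} \<longrightarrow> (\<forall>\<^sub>F m in sequentially. \<forall>f\<in>F m.
        (\<forall>j\<le>2*d m. q m f a j = 0) \<or>
        r m ^ (2 * d m) * r m ^ (2 * d m) \<le> norm (\<Sum>j\<le>2*d m. q m f a j * cis b ^ j))"
        by (rule AE_trig_poly_lower_bound[where \<eta> = "\<lambda>m. r m ^ (2 * d m)" and M = M])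
           (use fin r M sm2 in auto)
      then show ?thesis
      proof eventually_elim
        case (elim b)
        show ?case
        proof (intro impI)
          assume "fst (a, b) \<in> {0..pi} \<and> snd (a, b) \<in> {0..pi}"
          with elim have "\<forall>\<^sub>F m in sequentially. \<forall>f\<in>F m.
            (\<forall>j\<le>2*d m. q m f a j = 0) \<or>
            r m ^ (2 * d m) * r m ^ (2 * d m) \<le> norm (\<Sum>j\<le>2*d m. q m f a j * cis b ^ j)" by simp
          then show "\<forall>\<^sub>F m in sequentially. \<forall>f\<in>F m. f (fst (a, b)) (snd (a, b)) = 0 \<or>
             r m ^ (4 * d m) \<le> norm (f (fst (a, b)) (snd (a, b)))"
          proof (rule eventually_mono, intro ballI)
            fix m f
            assume *: "\<forall>f\<in>F m. (\<forall>j\<le>2*d m. q m f a j = 0) \<or>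
              r m ^ (2 * d m) * r m ^ (2 * d m) \<le> norm (\<Sum>j\<le>2*d m. q m f a j * cis b ^ j)"
              and f: "f \<in> F m"
            have "norm (f a b) = 0 \<or> r m ^ (2 * d m) * r m ^ (2 * d m) \<le> norm (f a b)"
              using bspec[OF * f] unfolding norm_f[OF f] by auto
            then show "f (fst (a, b)) (snd (a, b)) = 0 \<or> r m ^ (4 * d m) \<le> norm (f (fst (a, b)) (snd (a, b)))"
              by (simp flip: power_add)
          qed
        qed
      qed
    qed auto
  qed
  \<comment> \<open>Passing from almost every slice to almost every point of the plane needs the set
    itself to be measurable; continuity of the finitely many functions at each \<open>m\<close>
    provides this.\<close>
  have [measurable]: "(\<lambda>x. f (fst x) (snd x)) \<in> borel_measurable (lborel \<Otimes>\<^sub>M lborel)" if "f \<in> F m" for f m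
    using borel_measurable_continuous_onI[OF laurent_continuous_on[OF lau[OF that]]]
    by (simp add: lborel_prod)
  have "Measurable.pred (lborel \<Otimes>\<^sub>M lborel) (\<lambda>x. \<forall>f\<in>F m. f (fst x) (snd x) = 0 \<or>
      r m ^ (4 * d m) \<le> norm (f (fst x) (snd x)))" for m
    using fin by (intro pred_intros_finite) measurable
  then have "Measurable.pred (lborel \<Otimes>\<^sub>M lborel) ?G"
    unfolding eventually_sequentially by measurable
  then have "{x \<in> space (lborel \<Otimes>\<^sub>M lborel). ?G x} \<in> sets (lborel \<Otimes>\<^sub>M lborel)"
    by (rule predE)
  from lborel_pair.AE_pair_measure[OF this ae] show ?thesis
    unfolding lborel_prod .
qed

section \<open>Areas spanned by reflected vertices\<close>

text \<open>The determinant of two plane vectors; \<open>orient\<close> is accordingly twice the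
  signed area of a triangle.\<close>

definition cr :: "complex \<Rightarrow> complex \<Rightarrow> real" where
  "cr x y = Im (cnj x * y)"

definition orient :: "complex \<Rightarrow> complex \<Rightarrow> complex \<Rightarrow> real" where
  "orient a b c = cr (b - a) (c - a)"

definition reflect :: "complex \<Rightarrow> complex \<Rightarrow> complex \<Rightarrow> complex" where
  "reflect a b z = a + (b - a) / cnj (b - a) * cnj (z - a)"

text \<open>All reflections are in sides of the original triangle, and the newest one acts
  outermost. Unfolding composes frames with such reflections on the right, so these are the unfolded
  vertices relative to the first frame of a window.\<close>

primrec reflected_pts :: "complex set \<Rightarrow> nat \<Rightarrow> complex set" where
  "reflected_pts V 0 = V"
| "reflected_pts V (Suc m) = reflected_pts V m \<union>
     {reflect a b z | a b z. a \<in> V \<and> b \<in> V \<and> a \<noteq> b \<and> z \<in> reflected_pts V m}"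

lemma reflect_commute:
  assumes "a \<noteq> b"
  shows "reflect a b z = reflect b a z"
proof -
  have "(b - a) / cnj (b - a) * cnj (b - a) = b - a"
    using assms by simp
  moreover have "(a - b) / cnj (a - b) = (b - a) / cnj (b - a)"
    by (metis complex_cnj_minus minus_diff_eq minus_divide_divide)
  moreover have "cnj (z - a) = cnj (z - b) + cnj (b - a)" by simp
  ultimately show ?thesis
    unfolding reflect_def by (simp only: distrib_left) simp
qed

text \<open>This factor clears the denominator of \<^const>\<open>tri_C\<close> and is purely imaginary, so that conjugation
  only changes its sign.\<close>
definition tri_scale :: "real \<Rightarrow> real \<Rightarrow> complex" where
  "tri_scale a b = cis (a + b) - cis (- (a + b))"

text \<open>The vertices and the three reflections of \<open>reflect_side\<close>, multiplied by
  \<open>tri_scale\<close>. The minus signs arise because \<open>tri_scale\<close> is the negative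
  of its conjugate. Working with functions of the angles keeps the family independent of the
  triangle, which the measure argument requires.\<close>

primrec scaled_pts :: "nat \<Rightarrow> (real \<Rightarrow> real \<Rightarrow> complex) set" where
  "scaled_pts 0 = {\<lambda>a b. 0, tri_scale, \<lambda>a b. cis (a + b) - cis (a - b)}"
| "scaled_pts (Suc m) = scaled_pts m \<union>
     ((\<lambda>f a b. - cnj (f a b)) ` scaled_pts m \<union>
     ((\<lambda>f a b. - (cis (2 * a) * cnj (f a b))) ` scaled_pts m \<union>
      (\<lambda>f a b. tri_scale a b + cis (- 2 * b) * (- cnj (f a b) - tri_scale a b)) ` scaled_pts m))"

lemma finite_scaled_pts: "finite (scaled_pts m)"
  by (induction m) auto

lemma card_scaled_pts: "card (scaled_pts m) \<le> 3 * 4 ^ m"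
proof (induction m)
  case 0
  then show ?case
    by (simp add: card_insert_le_m1)
next
  case (Suc m)
  have "card (A \<union> (f ` A \<union> (g ` A \<union> h ` A))) \<le> 4 * card A" if "finite A"
    for A :: "(real \<Rightarrow> real \<Rightarrow> complex) set" and f g h :: "_ \<Rightarrow> real \<Rightarrow> real \<Rightarrow> complex"
    using card_Un_le[of A "f ` A \<union> (g ` A \<union> h ` A)"] card_Un_le[of "f ` A" "g ` A \<union> h ` A"]
      card_Un_le[of "g ` A" "h ` A"] card_image_le[OF that, of f] card_image_le[OF that, of g]
      card_image_le[OF that, of h] by linarith
  from this[OF finite_scaled_pts] have "card (scaled_pts (Suc m)) \<le> 4 * card (scaled_pts m)"
    by (simp only: scaled_pts.simps)
  with Suc show ?case by simp
qed

lemma laurent_tri_scale: "laurent (Suc d) tri_scale"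
proof -
  have "laurent (Suc d) (\<lambda>a b. cis (of_int 1 * a + of_int 1 * b) - cis (of_int (-1) * a + of_int (-1) * b))"
    by (intro laurent_diff laurent_monom) auto
  then show ?thesis unfolding tri_scale_def[abs_def] by simp
qed

lemma laurent_scaled_pts:
  assumes "f \<in> scaled_pts m"
  shows "laurent (2 * m + 1) f"
  using assms
proof (induction m arbitrary: f)
  case 0
  have "laurent 1 (\<lambda>a b. cis (of_int 1 * a + of_int 1 * b) - cis (of_int 1 * a + of_int (-1) * b))"
    by (intro laurent_diff laurent_monom) auto
  then show ?case
    using 0 laurent_zero laurent_tri_scale[of 0] by auto
next
  case (Suc m)
  let ?L = "laurent (2 * Suc m + 1)"
  have "?L f" if "laurent (2 * m + 1) f" for f
    using that by (rule laurent_le) simp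
  moreover have "?L (\<lambda>a b. - cnj (f a b))" if "laurent (2 * m + 1) f" for f
    by (rule laurent_le[OF laurent_uminus[OF laurent_cnj[OF that]]]) simp
  moreover have "?L (\<lambda>a b. - (cis (2 * a) * cnj (f a b)))" if "laurent (2 * m + 1) f" for f
    using laurent_uminus[OF laurent_cis_mult[OF laurent_cnj[OF that], of 2 2 0]] by simp
  moreover have "?L (\<lambda>a b. tri_scale a b + cis (- 2 * b) * (- cnj (f a b) - tri_scale a b))"
    if "laurent (2 * m + 1) f" for f
  proof -
    have "laurent (2 * m + 1) (\<lambda>a b. - cnj (f a b) - tri_scale a b)"
      using laurent_tri_scale by (intro laurent_diff laurent_uminus laurent_cnj that) simp
    from laurent_add[OF laurent_tri_scale laurent_cis_mult[OF this, of 0 2 "-2", simplified]]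
    show ?thesis by simp
  qed
  ultimately show ?case
    using Suc by auto
qed

locale angles =
  fixes \<alpha> \<beta> :: real
  assumes pos: "0 < \<alpha>" "0 < \<beta>" "\<alpha> + \<beta> < pi"
begin

lemma sin_pos: "0 < sin \<alpha>" "0 < sin \<beta>" "0 < sin (\<alpha> + \<beta>)"
  using pos by (auto intro!: sin_gt_zero)

lemma tri_scale_eq: "tri_scale \<alpha> \<beta> = 2 * \<i> * sin (\<alpha> + \<beta>)"
  unfolding tri_scale_def cis_cnj[symmetric] by (simp add: complex_eq_iff)

lemma tri_scale_nonzero: "tri_scale \<alpha> \<beta> \<noteq> 0"
  using sin_pos unfolding tri_scale_eq by (simp add: complex_eq_iff)

lemma cnj_tri_scale: "cnj (tri_scale \<alpha> \<beta>) = - tri_scale \<alpha> \<beta>"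
  unfolding tri_scale_eq by simp

lemma norm_tri_scale_le: "norm (tri_scale \<alpha> \<beta>) \<le> 2"
  unfolding tri_scale_eq by (simp add: norm_mult)

lemma tri_C_scaled: "tri_scale \<alpha> \<beta> * tri_C \<alpha> \<beta> = cis (\<alpha> + \<beta>) - cis (\<alpha> - \<beta>)"
proof -
  have "tri_scale \<alpha> \<beta> * tri_C \<alpha> \<beta> = 2 * \<i> * of_real (sin \<beta>) * cis \<alpha>"
    using sin_pos unfolding tri_scale_eq tri_C_def by simp
  also have "\<dots> = cis (\<alpha> + \<beta>) - cis (\<alpha> - \<beta>)"
    by (simp add: complex_eq_iff sin_add cos_add sin_diff cos_diff)
  finally show ?thesis .
qed

lemma tri_C_minus_1: "tri_C \<alpha> \<beta> - 1 = - of_real (sin \<alpha> / sin (\<alpha> + \<beta>)) * cis (- \<beta>)"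
proof -
  define s where "s = sin (\<alpha> + \<beta>)"
  have "sin \<alpha> * cos \<beta> + sin \<beta> * cos \<alpha> = s"
    unfolding s_def by (simp add: sin_add)
  moreover have "0 < s" using sin_pos s_def by simp
  ultimately have "sin \<alpha> * cos \<beta> / s + sin \<beta> * cos \<alpha> / s = 1"
    by (simp add: add_divide_distrib[symmetric])
  then show ?thesis
    unfolding tri_C_def s_def[symmetric] by (simp add: complex_eq_iff)
qed

lemma real_cis_div_cnj: "of_real r * cis t / cnj (of_real r * cis t) = cis (2 * t)" if "r \<noteq> 0" for r t
  using that by (simp add: cis_cnj cis_divide)

lemma reflect_side:
  assumes "x \<in> tri_verts \<alpha> \<beta>" "y \<in> tri_verts \<alpha> \<beta>" "x \<noteq> y"
  shows "reflect x y z \<in> {cnj z, cis (2 * \<alpha>) * cnj z, 1 + cis (- 2 * \<beta>) * (cnj z - 1)}"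
proof -
  let ?C = "tri_C \<alpha> \<beta>"
  have r1: "reflect 0 1 z = cnj z"
    unfolding reflect_def by simp
  have "?C / cnj ?C = cis (2 * \<alpha>)"
    unfolding tri_C_def using sin_pos by (intro real_cis_div_cnj) auto
  then have r2: "reflect 0 ?C z = cis (2 * \<alpha>) * cnj z"
    unfolding reflect_def by simp
  have "(?C - 1) / cnj (?C - 1) = cis (- 2 * \<beta>)"
    unfolding tri_C_minus_1 using real_cis_div_cnj[of "- sin \<alpha> / sin (\<alpha> + \<beta>)" "- \<beta>"] sin_pos by simp
  then have r3: "reflect 1 ?C z = 1 + cis (- 2 * \<beta>) * (cnj z - 1)"
    unfolding reflect_def by simp
  show ?thesis
    using assms r1 r2 r3 reflect_commute[of x y z] unfolding tri_verts_def by auto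
qed

lemma reflected_pts_scaled:
  assumes "z \<in> reflected_pts (tri_verts \<alpha> \<beta>) m"
  shows "\<exists>f\<in>scaled_pts m. tri_scale \<alpha> \<beta> * z = f \<alpha> \<beta>"
  using assms
proof (induction m arbitrary: z)
  case 0
  then show ?case using tri_C_scaled unfolding tri_verts_def by auto
next
  case (Suc m)
  let ?S = "tri_scale \<alpha> \<beta>"
  show ?case
  proof (cases "z \<in> reflected_pts (tri_verts \<alpha> \<beta>) m")
    case True
    then obtain f where "f \<in> scaled_pts m" "?S * z = f \<alpha> \<beta>" using Suc.IH by blast
    then show ?thesis by (intro bexI[of _ f]) auto
  next
    case False
    with Suc.prems obtain x y w where w: "w \<in> reflected_pts (tri_verts \<alpha> \<beta>) m" "z = reflect x y w"
      "x \<in> tri_verts \<alpha> \<beta>" "y \<in> tri_verts \<alpha> \<beta>" "x \<noteq> y" by auto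
    then obtain f where f: "f \<in> scaled_pts m" "?S * w = f \<alpha> \<beta>" using Suc.IH by blast
    have "?S * cnj w = - cnj (?S * w)" by (simp add: cnj_tri_scale)
    then have S: "?S * cnj w = - cnj (f \<alpha> \<beta>)" by (simp only: f)
    consider "z = cnj w" | "z = cis (2 * \<alpha>) * cnj w" | "z = 1 + cis (- 2 * \<beta>) * (cnj w - 1)"
      using reflect_side[OF w(3-5), of w] w(2) by blast
    then show ?thesis
    proof cases
      case 1
      then have "?S * z = (\<lambda>a b. - cnj (f a b)) \<alpha> \<beta>" using S by simp
      moreover have "(\<lambda>a b. - cnj (f a b)) \<in> scaled_pts (Suc m)" using f by auto
      ultimately show ?thesis by (rule rev_bexI[rotated])
    next
      case 2
      have "?S * z = cis (2 * \<alpha>) * (?S * cnj w)" unfolding 2 by simp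
      then have "?S * z = (\<lambda>a b. - (cis (2 * a) * cnj (f a b))) \<alpha> \<beta>" unfolding S by simp
      moreover have "(\<lambda>a b. - (cis (2 * a) * cnj (f a b))) \<in> scaled_pts (Suc m)" using f by auto
      ultimately show ?thesis by (rule rev_bexI[rotated])
    next
      case 3
      have "?S * z = ?S + cis (- 2 * \<beta>) * (?S * cnj w - ?S)"
        unfolding 3 by (simp add: algebra_simps)
      then have "?S * z = (\<lambda>a b. tri_scale a b + cis (- 2 * b) * (- cnj (f a b) - tri_scale a b)) \<alpha> \<beta>"
        unfolding S by simp
      moreover have "(\<lambda>a b. tri_scale a b + cis (- 2 * b) * (- cnj (f a b) - tri_scale a b)) \<in> scaled_pts (Suc m)"
        using f by auto
      ultimately show ?thesis by (rule rev_bexI[rotated])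
    qed
  qed
qed

end

text \<open>An imaginary part would not be an integer Laurent polynomial; subtracting the conjugate
  instead gives \<open>2 * \<i>\<close> times the doubled area, up to the squared modulus of
  \<open>tri_scale\<close>.\<close>

definition scaled_orient ::
  "(real \<Rightarrow> real \<Rightarrow> complex) \<times> (real \<Rightarrow> real \<Rightarrow> complex) \<times> (real \<Rightarrow> real \<Rightarrow> complex) \<Rightarrow> real \<Rightarrow> real \<Rightarrow> complex" where
  "scaled_orient = (\<lambda>(f, g, h) a b. cnj (g a b - f a b) * (h a b - f a b) - (g a b - f a b) * cnj (h a b - f a b))"

text \<open>There are at most \<open>27 * 64 ^ m\<close> triples, of degree
  \<open>4 * m + 2\<close>. The choice \<open>r = (1/256) ^ m\<close> leaves
  \<open>(1/4) ^ m\<close> times a polynomial, which is summable, and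
  \<open>r ^ (4 * (4 * m + 2))\<close> is the bound. The division by 8 pays for the squared modulus
  of \<open>tri_scale\<close>, at most 4, and the factor 2 in \<open>scaled_orient\<close>.\<close>

lemma AE_orient_gap:
  "AE x in lborel. 0 < fst x \<and> 0 < snd x \<and> fst x + snd x < pi \<longrightarrow> (\<forall>\<^sub>F m in sequentially.
     let P = reflected_pts (tri_verts (fst x) (snd x)) m in
     \<forall>u\<in>P. \<forall>v\<in>P. \<forall>w\<in>P. orient u v w = 0 \<or> (1 / 256) ^ (m * (16 * m + 8)) / 8 \<le> \<bar>orient u v w\<bar>)"
proof -
  define F where "F m = scaled_orient ` (scaled_pts m \<times> scaled_pts m \<times> scaled_pts m)" for m
  have fin: "finite (F m)" for m
    unfolding F_def by (simp add: finite_scaled_pts)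
  have cardF: "card (F m) \<le> 27 * 64 ^ m" for m
  proof -
    have "card (F m) \<le> card (scaled_pts m) * (card (scaled_pts m) * card (scaled_pts m))"
      unfolding F_def card_cartesian_product[symmetric] by (intro card_image_le finite_cartesian_product finite_scaled_pts)
    also have "\<dots> \<le> (3 * 4 ^ m) * ((3 * 4 ^ m) * (3 * 4 ^ m))"
      by (intro mult_le_mono card_scaled_pts)
    also have "\<dots> = 27 * (4 * 4 * 4) ^ m"
      by (simp only: power_mult_distrib)
    finally show ?thesis by simp
  qed
  have lau: "laurent (4 * m + 2) f" if f: "f \<in> F m" for f m
  proof -
    obtain f1 f2 f3 where *: "f = scaled_orient (f1, f2, f3)" "f1 \<in> scaled_pts m" "f2 \<in> scaled_pts m" "f3 \<in> scaled_pts m"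
      using f unfolding F_def by auto
    have "laurent ((2 * m + 1) + (2 * m + 1)) f"
      unfolding * scaled_orient_def prod.case
      by (intro laurent_diff[OF laurent_mult laurent_mult] laurent_cnj laurent_diff laurent_scaled_pts *)
    then show ?thesis by simp
  qed
  have "summable (\<lambda>m. 27 * (real (2 * (4 * m + 2) + 1) * (real (2 * (4 * m + 2)) * (2 * pi * (1/4) ^ m))))"
  proof (rule summable_comparison_test_bigo)
    show "summable (\<lambda>m. norm ((1/2) ^ m :: real))"
      by (simp add: summable_geometric)
  qed real_asymp
  then have sm: "summable (\<lambda>m. real (card (F m)) * (real (2 * (4 * m + 2) + 1) * (real (2 * (4 * m + 2)) * (2 * pi * (1/256) ^ m))))"
  proof (rule summable_comparison_test'[of _ 0])
    fix m
    have "real (card (F m)) \<le> 27 * 64 ^ m"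
      using cardF[of m] by (metis of_nat_le_iff of_nat_mult of_nat_numeral of_nat_power)
    then have "real (card (F m)) * (real (2 * (4 * m + 2) + 1) * (real (2 * (4 * m + 2)) * (2 * pi * (1/256) ^ m)))
      \<le> 27 * 64 ^ m * (real (2 * (4 * m + 2) + 1) * (real (2 * (4 * m + 2)) * (2 * pi * (1/256) ^ m)))"
      by (rule mult_right_mono) simp
    also have "\<dots> = 27 * (real (2 * (4 * m + 2) + 1) * (real (2 * (4 * m + 2)) * (2 * pi * (64 ^ m * (1/256) ^ m))))"
      by (simp only: mult_ac)
    also have "(64::real) ^ m * (1/256) ^ m = (1/4) ^ m"
      unfolding power_mult_distrib[symmetric] by simp
    finally show "norm (real (card (F m)) * (real (2 * (4 * m + 2) + 1) * (real (2 * (4 * m + 2)) * (2 * pi * (1/256) ^ m))))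
      \<le> 27 * (real (2 * (4 * m + 2) + 1) * (real (2 * (4 * m + 2)) * (2 * pi * (1/4) ^ m)))"
      by simp
  qed
  have "AE x in lborel. fst x \<in> {0..pi} \<and> snd x \<in> {0..pi} \<longrightarrow> (\<forall>\<^sub>F m in sequentially.
      \<forall>f\<in>F m. f (fst x) (snd x) = 0 \<or> ((1/256) ^ m) ^ (4 * (4 * m + 2)) \<le> norm (f (fst x) (snd x)))"
    by (rule AE_laurent_lower_bound[where d = "\<lambda>m. 4 * m + 2"]) (use fin lau sm in \<open>auto intro: power_le_one\<close>)
  then show ?thesis
  proof eventually_elim
    case (elim x)
    show ?case
    proof
      assume x: "0 < fst x \<and> 0 < snd x \<and> fst x + snd x < pi"
      define \<alpha> \<beta> where "\<alpha> = fst x" and "\<beta> = snd x"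
      interpret angles \<alpha> \<beta> using x by unfold_locales (auto simp: \<alpha>_def \<beta>_def)
      have "\<forall>\<^sub>F m in sequentially. \<forall>f\<in>F m. f \<alpha> \<beta> = 0 \<or> ((1/256) ^ m) ^ (4 * (4 * m + 2)) \<le> norm (f \<alpha> \<beta>)"
        using elim x unfolding \<alpha>_def \<beta>_def by auto
      then show "\<forall>\<^sub>F m in sequentially. let P = reflected_pts (tri_verts (fst x) (snd x)) m in
        \<forall>u\<in>P. \<forall>v\<in>P. \<forall>w\<in>P. orient u v w = 0 \<or> (1 / 256) ^ (m * (16 * m + 8)) / 8 \<le> \<bar>orient u v w\<bar>"
        unfolding \<alpha>_def[symmetric] \<beta>_def[symmetric] Let_def
      proof (rule eventually_mono, intro ballI)
        fix m u v w
        assume gap: "\<forall>f\<in>F m. f \<alpha> \<beta> = 0 \<or> ((1/256) ^ m) ^ (4 * (4 * m + 2)) \<le> norm (f \<alpha> \<beta>)"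
          and uvw: "u \<in> reflected_pts (tri_verts \<alpha> \<beta>) m" "v \<in> reflected_pts (tri_verts \<alpha> \<beta>) m"
            "w \<in> reflected_pts (tri_verts \<alpha> \<beta>) m"
        obtain f g h where fgh: "f \<in> scaled_pts m" "g \<in> scaled_pts m" "h \<in> scaled_pts m"
          "f \<alpha> \<beta> = tri_scale \<alpha> \<beta> * u" "g \<alpha> \<beta> = tri_scale \<alpha> \<beta> * v" "h \<alpha> \<beta> = tri_scale \<alpha> \<beta> * w"
          using reflected_pts_scaled[OF uvw(1)] reflected_pts_scaled[OF uvw(2)]
            reflected_pts_scaled[OF uvw(3)] by force
        let ?E = "scaled_orient (f, g, h) \<alpha> \<beta>"
        have "?E \<in> (\<lambda>f. f \<alpha> \<beta>) ` F m" using fgh unfolding F_def by auto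
        with gap have E: "?E = 0 \<or> ((1/256) ^ m) ^ (4 * (4 * m + 2)) \<le> norm ?E" by auto
        have "?E = (tri_scale \<alpha> \<beta> * cnj (tri_scale \<alpha> \<beta>)) * (cnj (v - u) * (w - u) - cnj (cnj (v - u) * (w - u)))"
          unfolding scaled_orient_def prod.case fgh by (simp add: algebra_simps)
        also have "cnj (v - u) * (w - u) - cnj (cnj (v - u) * (w - u)) = 2 * \<i> * of_real (orient u v w)"
          unfolding orient_def cr_def complex_diff_cnj by simp
        finally have nE: "norm ?E = (norm (tri_scale \<alpha> \<beta>))\<^sup>2 * (2 * \<bar>orient u v w\<bar>)"
          by (simp add: norm_mult power2_eq_square)
        have "(norm (tri_scale \<alpha> \<beta>))\<^sup>2 \<le> 2\<^sup>2"
          by (rule power_mono[OF norm_tri_scale_le]) simp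
        then have "norm ?E \<le> 8 * \<bar>orient u v w\<bar>"
          unfolding nE using mult_right_mono[of "(norm (tri_scale \<alpha> \<beta>))\<^sup>2" 4 "2 * \<bar>orient u v w\<bar>"] by simp
        moreover have "orient u v w = 0" if "?E = 0"
          using nE that tri_scale_nonzero by simp
        moreover have "((1/256::real) ^ m) ^ (4 * (4 * m + 2)) = (1 / 256) ^ (m * (16 * m + 8))"
          unfolding power_mult[symmetric] by (simp add: algebra_simps)
        ultimately show "orient u v w = 0 \<or> (1 / 256) ^ (m * (16 * m + 8)) / 8 \<le> \<bar>orient u v w\<bar>"
          using E by (elim disjE) auto
      qed
    qed
  qed
qed

section \<open>Beams\<close>

lemma cr_add: "cr (x + y) z = cr x z + cr y z" "cr z (x + y) = cr z x + cr z y"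
  by (simp_all add: cr_def algebra_simps)

lemma cr_diff: "cr (x - y) z = cr x z - cr y z" "cr z (x - y) = cr z x - cr z y"
  by (simp_all add: cr_def algebra_simps)

lemma cr_scale: "cr (of_real a * x) z = a * cr x z" "cr z (of_real a * x) = a * cr z x"
  by (simp_all add: cr_def algebra_simps)

lemma cr_self: "cr x x = 0"
  by (simp add: cr_def)

lemma cr_swap: "cr x y = - cr y x"
  by (simp add: cr_def)

text \<open>The three-term Pluecker relation: it expands a vector in the basis of two others, and is
  used whenever positions of rays and vertices have to be compared.\<close>

lemma cr_plucker: "cr x y * cr z w = cr z y * cr x w + cr x z * cr y w"
  by (simp add: cr_def algebra_simps)

lemma cr_eq_0_imp:
  assumes "cr z x = 0" "cr z y = 0" "cr x y \<noteq> 0"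
  shows "z = 0"
proof -
  have "Re z * cr x y = 0" "Im z * cr x y = 0"
    using assms(1,2) unfolding cr_def by (simp_all add: algebra_simps) algebra+
  then show ?thesis using assms(3) by (simp add: complex_eq_iff)
qed

lemma orient_eq_cr: "orient a b c = cr a b + cr b c + cr c a"
  by (simp add: orient_def cr_def algebra_simps)

lemma orient_degenerate: "orient x x y = 0" "orient x y y = 0" "orient x y x = 0"
  by (simp_all add: orient_def cr_def algebra_simps)

lemma orient_perm:
  "orient a c b = - orient a b c" "orient b a c = - orient a b c" "orient c b a = - orient a b c"
  "orient b c a = orient a b c" "orient c a b = orient a b c"
  unfolding orient_eq_cr using cr_swap[of a b] cr_swap[of b c] cr_swap[of a c] by simp_all

lemma reflect_fixes: "reflect a b a = a" "a \<noteq> b \<Longrightarrow> reflect a b b = b"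
  by (simp_all add: reflect_def)

definition motion :: "(complex \<Rightarrow> complex) \<Rightarrow> bool" where
  "motion g \<longleftrightarrow> (\<exists>u t. norm u = 1 \<and> (g = (\<lambda>z. u * z + t) \<or> g = (\<lambda>z. u * cnj z + t)))"

lemma motion_reflect:
  assumes "a \<noteq> b"
  shows "motion (reflect a b)"
proof -
  have "reflect a b = (\<lambda>z. (b - a) / cnj (b - a) * cnj z + (a - (b - a) / cnj (b - a) * cnj a))"
    by (simp add: reflect_def fun_eq_iff algebra_simps diff_divide_distrib)
  moreover have "norm ((b - a) / cnj (b - a)) = 1"
    using assms by (simp add: norm_divide del: complex_cnj_diff)
  ultimately show ?thesis unfolding motion_def by blast
qed

lemma motion_comp:
  assumes "motion f" "motion g"
  shows "motion (f \<circ> g)"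
proof -
  obtain u t where f: "norm u = 1" "f = (\<lambda>z. u * z + t) \<or> f = (\<lambda>z. u * cnj z + t)"
    using assms(1) unfolding motion_def by blast
  obtain v s where g: "norm v = 1" "g = (\<lambda>z. v * z + s) \<or> g = (\<lambda>z. v * cnj z + s)"
    using assms(2) unfolding motion_def by blast
  have "(f \<circ> g = (\<lambda>z. (u * v) * z + (u * s + t)) \<or> f \<circ> g = (\<lambda>z. (u * v) * cnj z + (u * s + t))) \<or>
    (f \<circ> g = (\<lambda>z. (u * cnj v) * z + (u * cnj s + t)) \<or> f \<circ> g = (\<lambda>z. (u * cnj v) * cnj z + (u * cnj s + t)))"
    using f(2) g(2) by (auto simp: fun_eq_iff algebra_simps)
  moreover have "norm (u * v) = 1" "norm (u * cnj v) = 1"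
    using f g by (simp_all add: norm_mult)
  ultimately show ?thesis unfolding motion_def by blast
qed

lemma motion_dist: "motion g \<Longrightarrow> norm (g x - g y) = norm (x - y)"
  unfolding motion_def
  by (auto simp: norm_mult complex_mod_cnj simp flip: right_diff_distrib complex_cnj_diff)

lemma motion_inj: "motion g \<Longrightarrow> g x = g y \<Longrightarrow> x = y"
  using motion_dist[of g x y] by simp

lemma motion_affine:
  assumes "motion g"
  shows "g (of_real (1 - t) * x + of_real t * y) = of_real (1 - t) * g x + of_real t * g y"
  using assms unfolding motion_def by (auto simp: algebra_simps)

lemma motion_orient:
  assumes "motion g"
  shows "\<exists>e\<in>{1, -1}. \<forall>x y z. orient (g x) (g y) (g z) = e * orient x y z"
proof -
  obtain u t where u: "norm u = 1" and g: "g = (\<lambda>z. u * z + t) \<or> g = (\<lambda>z. u * cnj z + t)"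
    using assms unfolding motion_def by blast
  have uu: "cnj u * u = 1"
    using u complex_norm_square[of u] by (simp add: mult.commute)
  have 1: "cr (u * x) (u * y) = cr x y" for x y
  proof -
    have "cnj (u * x) * (u * y) = (cnj u * u) * (cnj x * y)" by simp
    then show ?thesis by (simp only: cr_def uu mult_1)
  qed
  have 2: "cr (cnj x) (cnj y) = - cr x y" for x y
    by (simp add: cr_def)
  from g show ?thesis
  proof
    assume "g = (\<lambda>z. u * z + t)"
    then have "orient (g x) (g y) (g z) = 1 * orient x y z" for x y z
      using 1[of "y - x" "z - x"] unfolding orient_def by (simp add: right_diff_distrib)
    then show ?thesis by blast
  next
    assume "g = (\<lambda>z. u * cnj z + t)"
    then have "orient (g x) (g y) (g z) = (-1) * orient x y z" for x y z
      using 1[of "cnj (y - x)" "cnj (z - x)"] 2[of "y - x" "z - x"]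
      unfolding orient_def by (simp add: right_diff_distrib)
    then show ?thesis by blast
  qed
qed

lemma reflect_orient:
  assumes "a \<noteq> b"
  shows "orient (reflect a b x) (reflect a b y) (reflect a b z) = - orient x y z"
proof -
  define u where "u = (b - a) / cnj (b - a)"
  have "cnj u * u = 1"
    unfolding u_def using assms by (simp del: complex_cnj_diff)
  moreover have "cnj (u * cnj p) * (u * cnj q) = (cnj u * u) * cnj (cnj p * q)" for p q
    by simp
  ultimately have "cnj (u * cnj p) * (u * cnj q) = cnj (cnj p * q)" for p q
    by (metis mult_1)
  moreover have "reflect a b y - reflect a b x = u * cnj (y - x)"
      "reflect a b z - reflect a b x = u * cnj (z - x)"
    unfolding reflect_def u_def[symmetric] by (simp_all add: algebra_simps)
  ultimately show ?thesis
    unfolding orient_def cr_def by (simp only: cnj.simps)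
qed

section \<open>Beams of rays in the unfolding\<close>

text \<open>The mirror image is built in: with \<open>b\<close> for the left and
  \<open>\<not> b\<close> for the right, each geometric argument is made once and covers both
  sides.\<close>

definition crs :: "bool \<Rightarrow> complex \<Rightarrow> complex \<Rightarrow> real" where
  "crs b x y = (if b then cr x y else cr y x)"

lemma crs_Not: "crs (\<not> b) x y = crs b y x"
  by (simp add: crs_def)

lemma crs_linear:
  "crs b (x + y) z = crs b x z + crs b y z" "crs b z (x + y) = crs b z x + crs b z y"
  "crs b (x - y) z = crs b x z - crs b y z" "crs b z (x - y) = crs b z x - crs b z y"
  "crs b (of_real a * x) z = a * crs b x z" "crs b z (of_real a * x) = a * crs b z x"
  by (simp_all add: crs_def cr_add cr_diff cr_scale)

lemma crs_self: "crs b x x = 0"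
  by (simp add: crs_def cr_self)

lemma crs_swap: "crs b x y = - crs b y x"
  unfolding crs_def by (auto intro: cr_swap)

lemma crs_plucker: "crs b x y * crs b z w = crs b z y * crs b x w + crs b x z * crs b y w"
  by (cases b) (simp_all add: crs_def cr_def algebra_simps)

text \<open>\<open>frame\<close> maps the triangle to its current unfolded copy, with the starting vertex moved to the origin;
  \<open>side True\<close> and \<open>side False\<close> are the left and right end points, seen from the origin, of the side just crossed,
  before unfolding; \<open>dirs\<close> are the directions whose rays cross all sides so far.\<close>
datatype beam = Beam (frame: "complex \<Rightarrow> complex") (side: "bool \<Rightarrow> complex") (opp: complex) (dirs: "complex set")

text \<open>The bit \<open>b\<close> names the end point that is kept: the ray leaves through the
  side from \<open>side s b\<close> to \<open>opp s\<close>. Composing with a reflection in the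
  original side on the right amounts to reflecting the unfolded copy in its own side. The former end
  point on the other side becomes the new opposite vertex.\<close>

definition step :: "bool \<Rightarrow> beam \<Rightarrow> beam" where
  "step b s = Beam (frame s \<circ> reflect (side s b) (opp s)) ((side s)(\<not> b := opp s)) (side s (\<not> b))
     (dirs s \<inter> {d. 0 < crs b (frame s (opp s)) d})"

primrec run :: "bool list \<Rightarrow> beam \<Rightarrow> beam" where
  "run [] s = s"
| "run (b # u) s = run u (step b s)"

lemma run_append: "run (u @ v) s = run v (run u s)"
  by (induction u arbitrary: s) auto

definition end_pt :: "beam \<Rightarrow> bool \<Rightarrow> complex" where
  "end_pt s b = frame s (side s b)"

definition tip :: "beam \<Rightarrow> complex" where
  "tip s = frame s (opp s)"

definition splits :: "beam \<Rightarrow> bool" where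
  "splits s \<longleftrightarrow> tip s \<in> dirs s"

text \<open>The first orientation says that the tip lies beyond the side just crossed. The side is
  required to span a positive angle only while the beam is nonempty, since a code that no ray
  follows may wind around the origin. The last clause makes the beam a convex cone, which may be
  narrower than the cone over the side.\<close>

definition valid :: "complex set \<Rightarrow> beam \<Rightarrow> bool" where
  "valid V s \<longleftrightarrow> motion (frame s) \<and> {side s False, side s True, opp s} = V \<and>
     0 < orient (end_pt s False) (tip s) (end_pt s True) \<and>
     (dirs s \<noteq> {} \<longrightarrow> 0 < cr (end_pt s False) (end_pt s True)) \<and>
     (\<forall>d\<in>dirs s. 0 < cr (end_pt s False) d \<and> 0 < cr d (end_pt s True)) \<and>
     (\<forall>x\<in>dirs s. \<forall>y\<in>dirs s. \<forall>a>0. \<forall>b>0. of_real a * x + of_real b * y \<in> dirs s)"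

lemma validD:
  assumes "valid V s"
  shows "motion (frame s)" "{side s b, side s (\<not> b), opp s} = V"
    "0 < crs b (tip s) (end_pt s b) + crs b (end_pt s (\<not> b)) (tip s) - crs b (end_pt s (\<not> b)) (end_pt s b)"
    "dirs s \<noteq> {} \<Longrightarrow> 0 < crs b (end_pt s (\<not> b)) (end_pt s b)"
    "d \<in> dirs s \<Longrightarrow> 0 < crs b (end_pt s (\<not> b)) d" "d \<in> dirs s \<Longrightarrow> 0 < crs b d (end_pt s b)"
    "\<lbrakk>x \<in> dirs s; y \<in> dirs s; 0 < k; 0 < l\<rbrakk> \<Longrightarrow> of_real k * x + of_real l * y \<in> dirs s"
  using assms unfolding valid_def orient_eq_cr crs_def
  by (cases b; auto simp: cr_swap[of "end_pt s True" "end_pt s False"])+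

lemma valid_distinct:
  assumes "valid V s"
  shows "side s b \<noteq> opp s" "side s b \<noteq> side s (\<not> b)"
proof -
  have "0 < orient (end_pt s False) (tip s) (end_pt s True)"
    using assms unfolding valid_def by blast
  then show "side s b \<noteq> opp s" "side s b \<noteq> side s (\<not> b)"
    unfolding end_pt_def tip_def
    by (cases b; auto simp: orient_degenerate)+
qed

lemma dirs_step: "dirs (step b s) = dirs s \<inter> {d. 0 < crs b (tip s) d}"
  by (simp add: step_def tip_def)

lemma end_pt_step:
  assumes "valid V s"
  shows "end_pt (step b s) b = end_pt s b" "end_pt (step b s) (\<not> b) = tip s"
  using valid_distinct[OF assms] unfolding end_pt_def tip_def step_def
  by (auto simp: reflect_fixes)

lemma dirs_scale:
  assumes "valid V s" "d \<in> dirs s" "0 < a"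
  shows "of_real a * d \<in> dirs s"
proof -
  have "of_real (a / 2) * d + of_real (a / 2) * d \<in> dirs s"
    by (rule validD(7)[OF assms(1)]) (use assms in auto)
  then show ?thesis by (simp add: field_simps)
qed

lemma valid_step:
  assumes v: "valid V s"
  shows "valid V (step b s)"
proof -
  let ?s = "step b s" and ?\<sigma> = "reflect (side s b) (opp s)"
  let ?L = "end_pt s b" and ?R = "end_pt s (\<not> b)"
  note ds = valid_distinct[OF v]
  have 1: "motion (frame ?s)"
    unfolding step_def using ds validD(1)[OF v] by (simp add: motion_comp motion_reflect)
  have 2: "{side ?s False, side ?s True, opp ?s} = V"
    using validD(2)[OF v, of b] by (cases b) (auto simp: step_def)
  have 3: "0 < orient (end_pt ?s False) (tip ?s) (end_pt ?s True)"
  proof -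
    obtain e where e: "\<And>x y z. orient (frame s x) (frame s y) (frame s z) = e * orient x y z"
      using motion_orient[OF validD(1)[OF v]] by blast
    have ori: "orient (frame s (?\<sigma> x)) (frame s (?\<sigma> y)) (frame s (?\<sigma> z)) = - (e * orient x y z)" for x y z
      unfolding e reflect_orient[OF ds(1)] by simp
    have "0 < orient (end_pt s False) (tip s) (end_pt s True)"
      using v unfolding valid_def by blast
    then have "0 < e * orient (side s False) (opp s) (side s True)"
      unfolding end_pt_def tip_def e .
    moreover have "orient (end_pt ?s False) (tip ?s) (end_pt ?s True) =
      - (e * orient (side ?s False) (opp ?s) (side ?s True))"
      unfolding end_pt_def tip_def ori[symmetric] by (simp add: step_def)
    \<comment> \<open>Reflecting reverses the orientation, and so does exchanging an end point with
      the opposite vertex; the two signs cancel.\<close>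
    moreover have "orient (side ?s False) (opp ?s) (side ?s True) = - orient (side s False) (opp s) (side s True)"
      using orient_perm(2)[of "side s False" "opp s" "side s True"]
        orient_perm(1)[of "side s False" "opp s" "side s True"]
      by (cases b) (simp_all add: step_def)
    ultimately show ?thesis by simp
  qed
  \<comment> \<open>If the tip lay at or beyond \<open>?L\<close>, it would also be beyond
    \<open>?R\<close>, and expanding through the Pluecker relation would put \<open>d\<close> on the
    wrong side of the tip.\<close>
  have tL: "0 < crs b (tip s) ?L" if d: "d \<in> dirs ?s" for d
  proof (rule ccontr)
    assume *: "\<not> 0 < crs b (tip s) ?L"
    have dd: "d \<in> dirs s" "0 < crs b (tip s) d" using d by (auto simp: dirs_step)
    then have K: "0 < crs b ?R ?L" using validD(4)[OF v] by blast
    have a: "0 < crs b d ?L" "0 < crs b ?R d"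
      using validD(5,6)[OF v dd(1)] by auto
    have "crs b ?R (tip s) > 0"
      using validD(3)[OF v, of b] K * by linarith
    then have "crs b (tip s) ?R < 0"
      using crs_swap[of b "tip s" ?R] by simp
    then have "crs b d ?L * crs b (tip s) ?R < 0" using a by (simp add: mult_pos_neg)
    moreover have "crs b ?R d * crs b (tip s) ?L \<le> 0"
      using a * by (simp add: mult_nonneg_nonpos)
    moreover have "crs b ?R ?L * crs b d (tip s) = crs b d ?L * crs b ?R (tip s) + crs b ?R d * crs b ?L (tip s)"
      by (rule crs_plucker)
    then have "crs b ?R ?L * crs b (tip s) d = crs b d ?L * crs b (tip s) ?R + crs b ?R d * crs b (tip s) ?L"
      using crs_swap[of b d "tip s"] crs_swap[of b ?R "tip s"] crs_swap[of b ?L "tip s"] by simp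
    moreover have "crs b ?R ?L * crs b (tip s) d > 0" using K dd by simp
    ultimately show False by linarith
  qed
  have 4: "0 < cr (end_pt ?s False) (end_pt ?s True)" if "dirs ?s \<noteq> {}"
    using that tL end_pt_step[OF v, of b] by (cases b) (auto simp: crs_def)
  have 5: "0 < cr (end_pt ?s False) d \<and> 0 < cr d (end_pt ?s True)" if d: "d \<in> dirs ?s" for d
  proof -
    have "d \<in> dirs s" "0 < crs b (tip s) d" using d by (auto simp: dirs_step)
    then show ?thesis
      using end_pt_step[OF v, of b] validD(6)[OF v, of d b] by (cases b) (auto simp: crs_def)
  qed
  have 6: "of_real k * x + of_real l * y \<in> dirs ?s" if "x \<in> dirs ?s" "y \<in> dirs ?s" "0 < k" "0 < l" for x y k l
    using that validD(7)[OF v] unfolding dirs_step by (auto simp: crs_linear add_pos_pos)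
  show ?thesis
    unfolding valid_def using 1 2 3 4 5 6 by blast
qed

lemma valid_run: "valid V s \<Longrightarrow> valid V (run u s)"
  by (induction u arbitrary: s) (auto intro: valid_step)

lemma dirs_run_subset: "dirs (run u s) \<subseteq> dirs s"
proof (induction u arbitrary: s)
  case (Cons b u)
  then show ?case using dirs_step[of b s] by fastforce
qed simp

text \<open>The ray in direction \<open>d\<close> meets the line through the end points of the side at \<open>exit_time s d\<close> times \<open>d\<close>.\<close>
definition exit_time :: "beam \<Rightarrow> complex \<Rightarrow> real" where
  "exit_time s d = cr (end_pt s False) (end_pt s True) / cr d (end_pt s True - end_pt s False)"

lemma exit_time_crs:
  "exit_time s d = crs b (end_pt s (\<not> b)) (end_pt s b) / crs b d (end_pt s b - end_pt s (\<not> b))"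
proof (cases b)
  case False
  have "cr (end_pt s False) (end_pt s True) = - cr (end_pt s True) (end_pt s False)" by (rule cr_swap)
  moreover have "cr d (end_pt s True - end_pt s False) = - cr d (end_pt s False - end_pt s True)"
    by (simp add: cr_diff)
  ultimately show ?thesis using False cr_swap[of "end_pt s False - end_pt s True" d]
      cr_swap[of "end_pt s True" "end_pt s False"]
    unfolding exit_time_def crs_def by simp
qed (simp add: exit_time_def crs_def)

lemma crs_side_pos:
  assumes "valid V s" "d \<in> dirs s"
  shows "0 < crs b d (end_pt s b - end_pt s (\<not> b))"
  using validD(5,6)[OF assms, of b] crs_swap[of b d "end_pt s (\<not> b)"] by (simp add: crs_linear)

text \<open>A ray reaches the next side only after the present one: the tip lies beyond the present
  side. The Pluecker relation turns this into the inequality with denominators cleared.\<close>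

lemma exit_time_step_mono:
  assumes v: "valid V s" and d: "d \<in> dirs (step b s)"
  shows "exit_time s d \<le> exit_time (step b s) d"
proof -
  let ?L = "end_pt s b" and ?R = "end_pt s (\<not> b)" and ?A = "tip s"
  have dd: "d \<in> dirs s" using d by (auto simp: dirs_step)
  note E = end_pt_step[OF v, of b]
  have pl: "crs b ?R ?L * crs b d ?A = crs b d ?L * crs b ?R ?A + crs b ?R d * crs b ?L ?A"
    by (rule crs_plucker)
  have "crs b d ?L * crs b ?R ?L \<le> crs b d ?L * (crs b ?A ?L + crs b ?R ?A)"
    using validD(3)[OF v, of b] validD(6)[OF v dd, of b] by (intro mult_left_mono) auto
  then have "crs b ?R ?L * crs b d (?L - ?A) \<le> crs b ?A ?L * crs b d (?L - ?R)"
    using pl crs_swap[of b ?L ?A] crs_swap[of b d ?R] by (simp add: crs_linear algebra_simps)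
  moreover have "0 < crs b d (?L - ?R)" by (rule crs_side_pos[OF v dd])
  moreover have "0 < crs b d (?L - ?A)"
    using crs_side_pos[OF valid_step[OF v] d, of b] unfolding E .
  ultimately show ?thesis
    unfolding exit_time_crs[of _ _ b] E by (simp add: divide_simps mult.commute)
qed

lemma exit_time_run_mono:
  assumes "valid V s" "d \<in> dirs (run u s)"
  shows "exit_time s d \<le> exit_time (run u s) d"
  using assms
proof (induction u arbitrary: s)
  case (Cons b u)
  have "d \<in> dirs (step b s)"
    using Cons.prems(2) dirs_run_subset[of u "step b s"] by auto
  then have "exit_time s d \<le> exit_time (step b s) d"
    by (rule exit_time_step_mono[OF Cons.prems(1)])
  also have "\<dots> \<le> exit_time (run u (step b s)) d"
    using Cons by (simp add: valid_step)
  finally show ?case by simp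
qed simp

text \<open>In its own direction the tip is reached at time 1, and it lies strictly beyond the
  side.\<close>

lemma exit_time_tip:
  assumes v: "valid V s" and "splits s"
  shows "exit_time s (tip s) < 1"
proof -
  have d: "tip s \<in> dirs s" using assms(2) by (simp add: splits_def)
  have "crs True (end_pt s False) (end_pt s True) < crs True (tip s) (end_pt s True - end_pt s False)"
    using validD(3)[OF v, of True] crs_swap[of True "tip s" "end_pt s False"] by (simp add: crs_linear)
  then show ?thesis
    unfolding exit_time_crs[of _ _ True] using crs_side_pos[OF v d, of True] by simp
qed

lemma cr_eq_0_imp_pos_multiple:
  assumes "cr x y = 0" "0 < cr x w" "0 < cr y w"
  shows "\<exists>k>0. y = of_real k * x"
proof -
  define k where "k = cr y w / cr x w"
  have "y - of_real k * x = 0"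
  proof (rule cr_eq_0_imp)
    show "cr (y - of_real k * x) x = 0"
      using assms(1) cr_swap[of y x] by (simp add: cr_diff cr_scale cr_self)
    show "cr (y - of_real k * x) w = 0"
      unfolding cr_diff cr_scale using assms unfolding k_def by simp
  qed (use assms in simp)
  moreover have "0 < k" using assms unfolding k_def by simp
  ultimately show ?thesis by auto
qed

lemma cr_tip_pos:
  assumes v: "valid V s" and "dirs s \<noteq> {}"
  shows "0 < cr (tip s) (end_pt s True - end_pt s False)"
proof -
  have "0 < cr (tip s) (end_pt s True) + cr (end_pt s False) (tip s) - cr (end_pt s False) (end_pt s True)"
    "0 < cr (end_pt s False) (end_pt s True)"
    using validD(3,4)[OF v, of True] assms(2) by (auto simp: crs_def)
  then show ?thesis using cr_swap[of "tip s" "end_pt s False"] by (simp add: cr_diff)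
qed

text \<open>A convex cone that misses the ray through the tip lies on one side of it: from
  directions on both sides a positive combination would be parallel to the tip.\<close>

lemma not_splits_step:
  assumes v: "valid V s" and ns: "\<not> splits s"
  shows "\<exists>b. dirs (step b s) = dirs s \<and> dirs (step (\<not> b) s) = {}"
proof -
  have side: "0 < cr d (end_pt s True - end_pt s False)" if "d \<in> dirs s" for d
    using crs_side_pos[OF v that, of True] by (simp add: crs_def)
  have no0: "cr (tip s) d \<noteq> 0" if d: "d \<in> dirs s" for d
  proof
    assume "cr (tip s) d = 0"
    then have "cr d (tip s) = 0" using cr_swap[of d] by simp
    then obtain k where "0 < k" "tip s = of_real k * d"
      using cr_eq_0_imp_pos_multiple[of d "tip s"] side[OF d] cr_tip_pos[OF v] d by blast
    then have "tip s \<in> dirs s" using dirs_scale[OF v d] by simp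
    with ns show False by (simp add: splits_def)
  qed
  have no2: "\<not> (0 < cr (tip s) x \<and> cr (tip s) y < 0)" if xy: "x \<in> dirs s" "y \<in> dirs s" for x y
  proof
    assume *: "0 < cr (tip s) x \<and> cr (tip s) y < 0"
    then have "of_real (- cr (tip s) y) * x + of_real (cr (tip s) x) * y \<in> dirs s"
      by (intro validD(7)[OF v] xy) auto
    moreover have "cr (tip s) (of_real (- cr (tip s) y) * x + of_real (cr (tip s) x) * y) = 0"
      by (simp only: cr_add cr_scale) simp
    ultimately show False using no0 by blast
  qed
  have T: "dirs (step True s) = dirs s \<inter> {d. 0 < cr (tip s) d}"
    "dirs (step False s) = dirs s \<inter> {d. cr (tip s) d < 0}"
    using cr_swap[of _ "tip s"] by (auto simp: dirs_step crs_def)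
  show ?thesis
  proof (cases "\<exists>x\<in>dirs s. 0 < cr (tip s) x")
    case True
    then have "\<forall>y\<in>dirs s. 0 < cr (tip s) y" using no0 no2 by (meson linorder_neqE_linordered_idom)
    then show ?thesis unfolding T by (intro exI[of _ True]) (auto simp: T)
  next
    case False
    then have "\<forall>y\<in>dirs s. cr (tip s) y < 0" using no0 by (meson linorder_neqE_linordered_idom)
    then show ?thesis by (intro exI[of _ False]) (auto simp: T)
  qed
qed

lemma affine_le_limit:
  fixes p q p' q' :: real
  assumes "\<And>e. 0 < e \<Longrightarrow> p + e * q \<le> p' + e * q'"
  shows "p \<le> p'"
proof (rule ccontr)
  assume "\<not> p \<le> p'"
  define c where "c = \<bar>q' - q\<bar> + 1"
  have c: "0 < c" "q' - q \<le> c" unfolding c_def by auto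
  define e where "e = (p - p') / (2 * c)"
  have e: "0 < e" using \<open>\<not> p \<le> p'\<close> c unfolding e_def by simp
  have "e * (q' - q) \<le> e * c" using e c by (intro mult_left_mono) auto
  also have "\<dots> = (p - p') / 2" unfolding e_def using c by simp
  finally show False using assms[OF e] \<open>\<not> p \<le> p'\<close> by (simp add: algebra_simps)
qed

text \<open>Two consecutive vertices \<open>W1\<close>, \<open>W2\<close> inside the beam are passed on opposite sides. The beam that remains
  lies between them and leaves through a side that starts at \<open>W2\<close> and passes behind \<open>W1\<close>, so no later
  vertex inside the beam is on the segment from \<open>W1\<close> to \<open>W2\<close>.\<close>
lemma not_collinear_after_turn:
  assumes v: "valid V s0" and sp0: "splits s0"
    and sp1: "splits (run u (step b s0))"
    and eq: "dirs (run u (step b s0)) = dirs (step b s0)"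
    and sp2: "splits (run u' (step (\<not> b) (run u (step b s0))))"
  shows "orient (tip s0) (tip (run u (step b s0))) (tip (run u' (step (\<not> b) (run u (step b s0))))) \<noteq> 0"
proof
  define s1 s' where "s1 = step b s0" and "s' = run u s1"
  define s2 s'' where "s2 = step (\<not> b) s'" and "s'' = run u' s2"
  note defs = s1_def s'_def s2_def s''_def
  assume "orient (tip s0) (tip (run u (step b s0))) (tip (run u' (step (\<not> b) (run u (step b s0))))) = 0"
  then have ori: "orient (tip s0) (tip s') (tip s'') = 0" unfolding defs .
  let ?W1 = "tip s0" and ?W2 = "tip s'" and ?W3 = "tip s''"
  have v1: "valid V s1" and v': "valid V s'" and v2: "valid V s2" and v'': "valid V s''"
    unfolding defs by (intro valid_step valid_run v)+
  have W1: "?W1 \<in> dirs s0" and W2: "?W2 \<in> dirs s'" and W3: "?W3 \<in> dirs s''"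
    using sp0 sp1 sp2 unfolding splits_def defs by auto
  have d1: "dirs s1 = dirs s0 \<inter> {d. 0 < crs b ?W1 d}" unfolding s1_def by (rule dirs_step)
  have d': "dirs s' = dirs s1" using eq unfolding defs .
  have d2: "dirs s2 = dirs s' \<inter> {d. 0 < crs b d ?W2}"
    unfolding s2_def using dirs_step[of "\<not> b" s'] crs_Not[of b] by auto
  have W3': "?W3 \<in> dirs s2" using W3 dirs_run_subset[of u' s2] unfolding s''_def by blast
  have c12: "0 < crs b ?W1 ?W2" using W2 d' d1 by auto
  have c13: "0 < crs b ?W1 ?W3" and c32: "0 < crs b ?W3 ?W2" using W3' d2 d' d1 by auto
  let ?L = "end_pt s0 b" and ?R2 = "end_pt s' (\<not> b)"
  \<comment> \<open>The functional \<open>crs b _ y\<close> equals \<open>k\<close> on the line of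
    the side through \<open>?R2\<close> and \<open>?W2\<close>, and exceeds \<open>k\<close> for
    points of the beam beyond that line. The plan is to show that \<open>?W3\<close> is beyond it,
    while \<open>?W1\<close> and \<open>?W2\<close> are not.\<close>
  define y where "y = ?W2 - ?R2"
  define k where "k = crs b ?R2 ?W2"
  have E1: "end_pt s1 b = ?L" "end_pt s1 (\<not> b) = ?W1" unfolding s1_def by (rule end_pt_step[OF v])+
  have E2: "end_pt s2 b = ?W2" "end_pt s2 (\<not> b) = ?R2"
    unfolding s2_def using end_pt_step[OF v', of "\<not> b"] by simp_all
  have g3: "k < crs b ?W3 y"
  proof -
    have "exit_time s2 ?W3 < 1"
      using exit_time_run_mono[OF v2, of ?W3 u'] W3 exit_time_tip[OF v''] sp2 unfolding defs by force
    moreover have "0 < crs b ?W3 y" using crs_side_pos[OF v2 W3', of b] unfolding E2 y_def .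
    ultimately show ?thesis
      unfolding exit_time_crs[of s2 _ b] E2 y_def[symmetric] k_def by simp
  qed
  have g2: "crs b ?W2 y = k"
    unfolding y_def k_def using crs_self[of b ?W2] crs_swap[of b ?W2 ?R2] by (simp add: crs_linear)
  have g1: "crs b ?W1 y \<le> k"
  proof -
    have WL: "0 < crs b ?W1 ?L"
      using validD(4)[OF v1, of b] W2 d' unfolding E1 by auto
    \<comment> \<open>\<open>?W1\<close> only bounds the remaining beam, so exit times cannot be
      compared in its direction. They are compared along \<open>?W1 + e * ?W2\<close>, and then
      \<open>e\<close> tends to 0.\<close>
    have "crs b ?W1 ?L * crs b ?W1 y + e * (crs b ?W1 ?L * crs b ?W2 y)
       \<le> crs b ?W1 ?L * k + e * (k * crs b ?W2 (?L - ?W1))" if e: "0 < e" for e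
    proof -
      let ?d = "?W1 + of_real e * ?W2"
      have "of_real 1 * ?W1 + of_real e * ?W2 \<in> dirs s0"
        using W1 W2 d' d1 e by (intro validD(7)[OF v]) auto
      then have "?d \<in> dirs s1"
        unfolding d1 using c12 e by (simp add: crs_linear crs_self)
      then have D2: "?d \<in> dirs s2"
        unfolding d2 d' using c12 e by (simp add: crs_linear crs_self)
      then have D': "?d \<in> dirs s'" by (simp add: d2)
      have "exit_time s1 ?d \<le> exit_time s' ?d"
        using exit_time_run_mono[OF v1, of ?d u] D' unfolding s'_def by blast
      also have "\<dots> \<le> exit_time s2 ?d"
        using exit_time_step_mono[OF v', of ?d "\<not> b"] D2 unfolding s2_def by blast
      finally have "crs b ?W1 ?L / crs b ?d (?L - ?W1) \<le> k / crs b ?d y"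
        unfolding exit_time_crs[of _ _ b] E1 E2 y_def k_def .
      moreover have "0 < crs b ?d (?L - ?W1)"
        using crs_side_pos[OF v1, of ?d b] D' d' unfolding E1 by auto
      moreover have "0 < crs b ?d y" using crs_side_pos[OF v2 D2, of b] unfolding E2 y_def .
      ultimately have "crs b ?W1 ?L * crs b ?d y \<le> k * crs b ?d (?L - ?W1)"
        by (simp add: divide_simps)
      moreover have "crs b ?d (?L - ?W1) = crs b ?W1 ?L + e * crs b ?W2 (?L - ?W1)"
        by (simp only: crs_linear crs_self) (simp add: algebra_simps)
      moreover have "crs b ?d y = crs b ?W1 y + e * crs b ?W2 y" by (simp add: crs_linear)
      ultimately show ?thesis by (simp add: algebra_simps)
    qed
    then have "crs b ?W1 ?L * crs b ?W1 y \<le> crs b ?W1 ?L * k" by (rule affine_le_limit)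
    then show ?thesis using WL by simp
  qed
  have "crs b ?W1 ?W2 + crs b ?W2 ?W3 + crs b ?W3 ?W1 = 0"
    using ori cr_swap[of ?W2 ?W1] cr_swap[of ?W3 ?W2] cr_swap[of ?W1 ?W3] unfolding orient_eq_cr crs_def by auto
  then have sum: "crs b ?W1 ?W2 = crs b ?W3 ?W2 + crs b ?W1 ?W3"
    using crs_swap[of b ?W2 ?W3] crs_swap[of b ?W3 ?W1] by simp
  \<comment> \<open>By \<open>sum\<close>, collinearity makes \<open>?W3\<close> a convex
    combination of \<open>?W1\<close> and \<open>?W2\<close>, so the functional is at most
    \<open>k\<close> there.\<close>
  have "crs b ?W1 ?W2 * crs b ?W3 y = crs b ?W3 ?W2 * crs b ?W1 y + crs b ?W1 ?W3 * crs b ?W2 y"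
    by (rule crs_plucker)
  also have "\<dots> \<le> crs b ?W3 ?W2 * k + crs b ?W1 ?W3 * k"
    unfolding g2 using g1 c32 by simp
  also have "\<dots> = crs b ?W1 ?W2 * k" unfolding sum by (simp add: algebra_simps)
  finally show False using g3 c12 by simp
qed

section \<open>Counting the descendants of a beam\<close>

primrec beam_count :: "nat \<Rightarrow> beam \<Rightarrow> nat" where
  "beam_count 0 s = (if dirs s = {} then 0 else 1)"
| "beam_count (Suc j) s = beam_count j (step True s) + beam_count j (step False s)"

lemma beam_count_Suc: "beam_count (Suc j) s = beam_count j (step b s) + beam_count j (step (\<not> b) s)"
  by (cases b) auto

lemma beam_count_empty: "dirs s = {} \<Longrightarrow> beam_count j s = 0"
  by (induction j arbitrary: s) (auto simp: dirs_step)

text \<open>Only vertices that split along one common code are compared. This is all that the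
  counting needs, and all the thinness of the starting beam can give.\<close>

definition collinear_splits :: "beam \<Rightarrow> nat \<Rightarrow> bool" where
  "collinear_splits s k \<longleftrightarrow> (\<forall>u v w. length u + length v + length w \<le> k \<longrightarrow> splits (run u s) \<longrightarrow>
     splits (run (u @ v) s) \<longrightarrow> splits (run (u @ v @ w) s) \<longrightarrow>
     orient (tip (run u s)) (tip (run (u @ v) s)) (tip (run (u @ v @ w) s)) = 0)"

lemma collinear_splits_run:
  assumes "collinear_splits s k" "length p + j \<le> k"
  shows "collinear_splits (run p s) j"
  unfolding collinear_splits_def
proof (intro allI impI)
  fix u v w
  assume "length u + length v + length w \<le> j" "splits (run u (run p s))"
    "splits (run (u @ v) (run p s))" "splits (run (u @ v @ w) (run p s))"
  then show "orient (tip (run u (run p s))) (tip (run (u @ v) (run p s))) (tip (run (u @ v @ w) (run p s))) = 0"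
    using assms(1)[unfolded collinear_splits_def, rule_format, of "p @ u" v w] assms(2)
    by (simp add: run_append)
qed

lemma beam_count_no_split:
  assumes "valid V s" "\<And>u. length u < j \<Longrightarrow> \<not> splits (run u s)"
  shows "beam_count j s \<le> 1"
  using assms
proof (induction j arbitrary: s)
  case (Suc j)
  obtain b where b: "dirs (step (\<not> b) s) = {}"
    using not_splits_step[OF Suc.prems(1)] Suc.prems(2)[of "[]"] by auto
  have "\<not> splits (run u (step b s))" if "length u < j" for u
    using Suc.prems(2)[of "b # u"] that by simp
  then have "beam_count j (step b s) \<le> 1"
    by (intro Suc.IH valid_step Suc.prems(1)) auto
  then show ?case
    using beam_count_empty[OF b] beam_count_Suc[of j s b] by simp
qed simp

text \<open>\<open>s0\<close> is the last split and \<open>b\<close> the side taken there; the path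
  \<open>p\<close> has met no split since. At the next split, the child on the same side becomes the
  new situation of this kind, while the child on the other side can never split again by
  \<open>not_collinear_after_turn\<close>. Each level thus adds at most one beam.\<close>

lemma beam_count_after_split:
  assumes "valid V s0" "splits s0" "dirs (run p (step b s0)) = dirs (step b s0)"
    and "collinear_splits s0 (length p + 1 + j)"
  shows "beam_count j (run p (step b s0)) \<le> j + 1"
  using assms
proof (induction j arbitrary: s0 p b)
  case (Suc j)
  define s where "s = run p (step b s0)"
  have v: "valid V s" unfolding s_def by (intro valid_run valid_step Suc.prems)
  have col: "collinear_splits s (Suc j)"
    using collinear_splits_run[OF Suc.prems(4), of "b # p" "Suc j"] unfolding s_def by simp
  show ?case
  proof (cases "splits s")
    case False
    then obtain c where c: "dirs (step c s) = dirs s" "dirs (step (\<not> c) s) = {}"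
      using not_splits_step[OF v] by blast
    have "beam_count j (run (p @ [c]) (step b s0)) \<le> j + 1"
      using c Suc.prems unfolding s_def by (intro Suc.IH) (simp_all add: run_append)
    then show ?thesis
      using beam_count_empty[OF c(2)] beam_count_Suc[of j s c] unfolding s_def by (simp add: run_append)
  next
    case True
    \<comment> \<open>The induction restarts with \<open>s\<close> as the last split and an empty
      path.\<close>
    have "beam_count j (run [] (step b s)) \<le> j + 1"
      using v True col by (intro Suc.IH) simp_all
    moreover have "beam_count j (step (\<not> b) s) \<le> 1"
    proof (rule beam_count_no_split[OF valid_step[OF v]])
      fix u :: "bool list"
      assume u: "length u < j"
      show "\<not> splits (run u (step (\<not> b) s))"
      proof
        assume sp: "splits (run u (step (\<not> b) s))"
        have "orient (tip s0) (tip s) (tip (run u (step (\<not> b) s))) \<noteq> 0"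
          using not_collinear_after_turn[OF Suc.prems(1,2), of p b u] True Suc.prems(3) sp
          unfolding s_def by blast
        moreover have "orient (tip s0) (tip s) (tip (run u (step (\<not> b) s))) = 0"
          using Suc.prems(4)[unfolded collinear_splits_def, rule_format, of "[]" "b # p" "(\<not> b) # u"]
            True sp u Suc.prems(2) unfolding s_def by (simp add: run_append)
        ultimately show False by blast
      qed
    qed
    ultimately show ?thesis
      using beam_count_Suc[of j s b] unfolding s_def by simp
  qed
qed simp

text \<open>Until the first split there is a single beam; each of its two children then falls under
  \<open>beam_count_after_split\<close>.\<close>

lemma beam_count_collinear:
  assumes "valid V s" "collinear_splits s j"
  shows "beam_count j s \<le> 2 * j + 1"
  using assms
proof (induction j arbitrary: s)
  case (Suc j)
  show ?case
  proof (cases "splits s")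
    case False
    then obtain c where c: "dirs (step (\<not> c) s) = {}"
      using not_splits_step[OF Suc.prems(1)] by blast
    have "collinear_splits (step c s) j"
      using collinear_splits_run[OF Suc.prems(2), of "[c]" j] by simp
    then have "beam_count j (step c s) \<le> 2 * j + 1"
      by (intro Suc.IH valid_step Suc.prems)
    then show ?thesis
      using beam_count_empty[OF c] beam_count_Suc[of j s c] by simp
  next
    case True
    have "beam_count j (run [] (step b s)) \<le> j + 1" for b
      using Suc.prems True by (intro beam_count_after_split) simp_all
    from this[of True] this[of False] show ?thesis by simp
  qed
qed simp

section \<open>Thin beams and windows of reflections\<close>

lemma reflected_pts_mono: "m \<le> n \<Longrightarrow> reflected_pts V m \<subseteq> reflected_pts V n"
  by (induction rule: dec_induct) auto

text \<open>Factoring out \<open>frame s\<close> leaves a point that depends only on the reflections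
  inside the window, so the area gap for window length \<open>m\<close> serves at every
  depth.\<close>

lemma tip_run:
  assumes "valid V s"
  shows "\<exists>y\<in>reflected_pts V (length u). tip (run u s) = frame s y"
  using assms
proof (induction u arbitrary: s)
  case Nil
  then show ?case using validD(2)[OF Nil, of True] by (auto simp: tip_def)
next
  case (Cons b u)
  obtain y where y: "y \<in> reflected_pts V (length u)" "tip (run u (step b s)) = frame (step b s) y"
    using Cons.IH[OF valid_step[OF Cons.prems]] by blast
  let ?y = "reflect (side s b) (opp s) y"
  have "?y \<in> reflected_pts V (Suc (length u))"
  proof -
    have "side s b \<in> V" "opp s \<in> V" using validD(2)[OF Cons.prems, of b] by auto
    then show ?thesis
      using y(1) valid_distinct(1)[OF Cons.prems, of b] unfolding reflected_pts.simps by blast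
  qed
  moreover have "tip (run (b # u) s) = frame s ?y" using y(2) by (simp add: step_def)
  ultimately show ?case by auto
qed

lemma norm_run_le:
  assumes "valid V s" and diam: "\<And>x y. x \<in> V \<Longrightarrow> y \<in> V \<Longrightarrow> norm (x - y) \<le> \<Delta>"
    and "norm (end_pt s True) \<le> B" "norm (end_pt s False) \<le> B" "norm (tip s) \<le> B"
  shows "norm (tip (run u s)) \<le> B + real (length u) * \<Delta>"
  using assms(1,3-)
proof (induction u arbitrary: s B)
  case (Cons b u)
  note E = end_pt_step[OF Cons.prems(1), of b]
  have b: "norm (end_pt s b) \<le> B" using Cons.prems by (cases b) auto
  have vs: "valid V (step b s)" by (intro valid_step Cons.prems)
  have V: "opp (step b s) \<in> V" "side (step b s) b \<in> V"
    using validD(2)[OF vs, of b] by auto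
  then have "0 \<le> \<Delta>" using diam[OF V(1) V(1)] by simp
  have "norm (tip (step b s) - end_pt (step b s) b) \<le> \<Delta>"
    unfolding tip_def end_pt_def motion_dist[OF validD(1)[OF vs]] by (rule diam[OF V])
  then have "norm (tip (step b s)) \<le> B + \<Delta>"
    using b norm_triangle_sub[of "tip (step b s)" "end_pt (step b s) b"] unfolding E(1) by linarith
  moreover have "norm (end_pt (step b s) True) \<le> B + \<Delta>" "norm (end_pt (step b s) False) \<le> B + \<Delta>"
    using E b Cons.prems(4) \<open>0 \<le> \<Delta>\<close> by (cases b; simp)+
  ultimately have "norm (tip (run u (step b s))) \<le> (B + \<Delta>) + real (length u) * \<Delta>"
    by (intro Cons.IH vs)
  then show ?case by (simp add: algebra_simps)
qed simp

text \<open>The factor 3 is there because \<open>orient\<close> is a sum of three cross products.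
  Without the cutoff \<open>R\<close> no nonempty open cone would qualify.\<close>

definition thin :: "real \<Rightarrow> real \<Rightarrow> complex set \<Rightarrow> bool" where
  "thin R \<delta> D \<longleftrightarrow> (\<forall>x\<in>D. \<forall>y\<in>D. norm x \<le> R \<longrightarrow> norm y \<le> R \<longrightarrow> 3 * \<bar>cr x y\<bar> < \<delta>)"

text \<open>All vertices that split within the window lie in \<open>dirs s\<close> and within
  distance \<open>R\<close>, so any three span less than \<open>\<delta>\<close>; moved back by the
  frame they fall under the gap.\<close>

lemma collinear_splits_thin:
  assumes v: "valid V s" and thin: "thin R \<delta> (dirs s)"
    and gap: "\<And>x y z. \<lbrakk>x \<in> reflected_pts V m; y \<in> reflected_pts V m; z \<in> reflected_pts V m\<rbrakk> \<Longrightarrow>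
      orient x y z = 0 \<or> \<delta> \<le> \<bar>orient x y z\<bar>"
    and R: "\<And>u. length u \<le> m \<Longrightarrow> norm (tip (run u s)) \<le> R"
  shows "collinear_splits s m"
  unfolding collinear_splits_def
proof (intro allI impI)
  fix p q r
  assume len: "length p + length q + length r \<le> m" and sp: "splits (run p s)"
    "splits (run (p @ q) s)" "splits (run (p @ q @ r) s)"
  obtain e where e: "e \<in> {1, -1}"
    "\<And>x y z. orient (frame s x) (frame s y) (frame s z) = e * orient x y z"
    using motion_orient[OF validD(1)[OF v]] by blast
  have pt: "\<exists>y\<in>reflected_pts V m. tip (run u s) = frame s y" if "length u \<le> m" for u
    using tip_run[OF v, of u] reflected_pts_mono[OF that, of V] by blast
  have D: "tip (run u s) \<in> dirs s" if "splits (run u s)" for u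
    using that dirs_run_subset[of u s] unfolding splits_def by blast
  obtain x y z where xyz: "x \<in> reflected_pts V m" "y \<in> reflected_pts V m" "z \<in> reflected_pts V m"
    "tip (run p s) = frame s x" "tip (run (p @ q) s) = frame s y" "tip (run (p @ q @ r) s) = frame s z"
    using pt[of p] pt[of "p @ q"] pt[of "p @ q @ r"] len by auto
  let ?x = "tip (run p s)" and ?y = "tip (run (p @ q) s)" and ?z = "tip (run (p @ q @ r) s)"
  have nR: "norm ?x \<le> R" "norm ?y \<le> R" "norm ?z \<le> R"
    using R[of p] R[of "p @ q"] R[of "p @ q @ r"] len by auto
  have "3 * \<bar>cr ?x ?y\<bar> < \<delta>" "3 * \<bar>cr ?y ?z\<bar> < \<delta>" "3 * \<bar>cr ?z ?x\<bar> < \<delta>"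
    using thin D sp nR unfolding thin_def by blast+
  then have "\<bar>orient ?x ?y ?z\<bar> < \<delta>" unfolding orient_eq_cr by linarith
  then have "\<bar>orient x y z\<bar> < \<delta>" using e unfolding xyz by (auto simp: abs_mult)
  then show "orient ?x ?y ?z = 0" using gap[OF xyz(1-3)] e unfolding xyz by auto
qed

lemma run_dirs_disjoint:
  assumes "length u = length v" "d \<in> dirs (run u s)" "d \<in> dirs (run v s)"
  shows "u = v"
  using assms
proof (induction u v arbitrary: s rule: list_induct2)
  case (Cons b u c v)
  have "d \<in> dirs (step b s)" "d \<in> dirs (step c s)"
    using Cons.prems dirs_run_subset by (auto dest: subsetD[OF dirs_run_subset])
  then have "0 < crs b (tip s) d" "0 < crs c (tip s) d" by (auto simp: dirs_step)
  then have "b = c" 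
    by (cases b; cases c) (auto simp: crs_def cr_swap[of d "tip s"])
  then show ?case using Cons by auto
qed simp

lemma finite_bool_lists: "finite {u :: bool list. length u = k}"
  using finite_lists_length_eq[OF finite_class.finite_UNIV, of k] by simp

lemma sum_bool_lists_Suc:
  "(\<Sum>u | length u = Suc k. f u) = (\<Sum>u | length u = k. f (True # u) + f (False # u) :: nat)"
proof -
  have fin: "finite {u :: bool list. length u = k}" by (rule finite_bool_lists)
  have "{u :: bool list. length u = Suc k} = (Cons True) ` {u. length u = k} \<union> (Cons False) ` {u. length u = k}"
    by (auto simp: length_Suc_conv image_iff)
  then have "(\<Sum>u | length u = Suc k. f u) =
     sum f (Cons True ` {u. length u = k} \<union> Cons False ` {u. length u = k})" by simp
  also have "\<dots> = sum f (Cons True ` {u. length u = k}) + sum f (Cons False ` {u. length u = k})"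
    by (rule sum.union_disjoint) (use fin in auto)
  also have "\<dots> = (\<Sum>u | length u = k. f (True # u)) + (\<Sum>u | length u = k. f (False # u))"
    by (simp add: sum.reindex inj_on_def)
  finally show ?thesis by (simp add: sum.distrib)
qed

lemma beam_count_add: "beam_count (k + m) s = (\<Sum>u | length u = k. beam_count m (run u s))"
proof (induction k arbitrary: s)
  case (Suc k)
  show ?case by (simp add: Suc sum_bool_lists_Suc sum.distrib)
qed simp

lemma beam_count_eq_card: "beam_count k s = card {u. length u = k \<and> dirs (run u s) \<noteq> {}}"
proof -
  have "beam_count k s = (\<Sum>u | length u = k. if dirs (run u s) \<noteq> {} then 1 else 0)"
    using beam_count_add[of k 0 s] by (auto intro: sum.cong)
  also have "\<dots> = card {u. length u = k \<and> dirs (run u s) \<noteq> {}}"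
    using finite_bool_lists[of k] by (subst sum.If_cases) (simp_all add: Int_def conj_commute)
  finally show ?thesis .
qed

lemma beam_count_le_power: "beam_count m s \<le> 2 ^ m"
proof (induction m arbitrary: s)
  case (Suc m)
  show ?case using add_mono[OF Suc.IH[of "step True s"] Suc.IH[of "step False s"]] by simp
qed simp

text \<open>A beam that is not thin contains one of the directions that divide the first side in ratio
  \<open>i\<eta> : 1 - i\<eta>\<close>, and beams with different codes are disjoint.\<close>
lemma card_not_thin_le:
  assumes v: "valid V s0" and R: "0 < R" and \<delta>: "0 < \<delta>" and K: "K = cr (end_pt s0 False) (end_pt s0 True)" "0 < K"
    and \<eta>: "\<eta> = \<delta> * K / (3 * (R * norm (end_pt s0 True - end_pt s0 False))\<^sup>2)"
  shows "real (card {u. length u = k \<and> \<not> thin R \<delta> (dirs (run u s0))}) \<le> 1 / \<eta>"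
proof -
  let ?r = "end_pt s0 False" and ?l = "end_pt s0 True"
  let ?e = "?l - ?r"
  have "?e \<noteq> 0" using K cr_self[of ?r] by auto
  then have \<eta>pos: "0 < \<eta>" unfolding \<eta> using \<delta> K R by simp
  \<comment> \<open>The affine coordinate, between 0 and 1, of the point where the ray meets the
    first side. By \<open>cr_t\<close>, cross products are differences of this coordinate up to
    bounded factors.\<close>
  define t where "t d = cr ?r d / cr d ?e" for d
  have den: "0 < cr d ?e" "0 < cr ?r d" "0 < cr d ?l" "cr d ?e = cr ?r d + cr d ?l" if "d \<in> dirs s0" for d
    using crs_side_pos[OF v that, of True] validD(5,6)[OF v that, of True] cr_swap[of d ?r]
    by (auto simp: crs_def cr_diff)
  have t01: "0 < t d" "t d < 1" if "d \<in> dirs s0" for d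
    using den[OF that] unfolding t_def by auto
  have cr_t: "K * cr x y = (t y - t x) * (cr x ?e * cr y ?e)" if "x \<in> dirs s0" "y \<in> dirs s0" for x y
  proof -
    have "K * cr x y = cr ?r y * cr x ?e - cr ?r x * cr y ?e"
      using cr_plucker[of ?r ?l x y] cr_swap[of x ?r] cr_swap[of y ?r] cr_swap[of ?l y]
      unfolding K by (simp add: cr_diff algebra_simps)
    moreover have "cr ?r x = t x * cr x ?e" "cr ?r y = t y * cr y ?e"
      using den(1)[OF that(1)] den(1)[OF that(2)] unfolding t_def by auto
    ultimately show ?thesis by (simp only:) (simp add: algebra_simps)
  qed
  have ncr: "\<bar>cr x y\<bar> \<le> norm x * norm y" for x y
    unfolding cr_def using abs_Im_le_cmod[of "cnj x * y"] by (simp add: norm_mult)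
  have ex: "\<exists>i. \<exists>z\<in>dirs (run u s0). t z = real i * \<eta>" if nt: "\<not> thin R \<delta> (dirs (run u s0))" for u
  proof -
    let ?D = "dirs (run u s0)"
    note vu = valid_run[OF v, of u]
    have D: "?D \<subseteq> dirs s0" by (rule dirs_run_subset)
    obtain x y where xy: "x \<in> ?D" "y \<in> ?D" "norm x \<le> R" "norm y \<le> R" "\<delta> \<le> 3 * \<bar>cr x y\<bar>"
      using nt unfolding thin_def by force
    have dist: "\<eta> \<le> \<bar>t y - t x\<bar>"
    proof -
      have "K * \<bar>cr x y\<bar> = \<bar>t y - t x\<bar> * (cr x ?e * cr y ?e)"
        using arg_cong[OF cr_t[of x y], of abs] xy D den(1)[of x] den(1)[of y] K by (simp add: abs_mult subset_iff)
      also have "\<dots> \<le> \<bar>t y - t x\<bar> * ((R * norm ?e) * (R * norm ?e))"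
      proof (intro mult_left_mono mult_mono)
        show "cr x ?e \<le> R * norm ?e" "cr y ?e \<le> R * norm ?e"
          using ncr[of x ?e] ncr[of y ?e] mult_right_mono[OF xy(3), of "norm ?e"] mult_right_mono[OF xy(4), of "norm ?e"] by auto
        show "0 \<le> cr y ?e" using den(1)[of y] xy D by fastforce
      qed (use R in auto)
      finally have "3 * (K * \<bar>cr x y\<bar>) \<le> 3 * (\<bar>t y - t x\<bar> * ((R * norm ?e) * (R * norm ?e)))"
        by simp
      moreover have "\<delta> * K \<le> (3 * \<bar>cr x y\<bar>) * K"
        using K(2) by (intro mult_right_mono xy(5)) simp
      ultimately have "\<delta> * K \<le> \<bar>t y - t x\<bar> * (3 * (R * norm ?e)\<^sup>2)"
        by (simp only: power2_eq_square mult_ac)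
      then show ?thesis
        unfolding \<eta> using R \<open>?e \<noteq> 0\<close> by (subst divide_le_eq) (simp add: mult_ac)
    qed
    \<comment> \<open>An intermediate value argument by hand: \<open>h\<close> is linear and
      vanishes exactly at coordinate \<open>c\<close>, and a positive combination of
      \<open>x\<close> and \<open>y\<close> is a zero of it. The value \<open>c\<close> is the first
      multiple of \<open>\<eta>\<close> not below \<open>t x\<close>.\<close>
    have gen: "\<exists>i. \<exists>z\<in>?D. t z = real i * \<eta>" if xy: "x \<in> ?D" "y \<in> ?D" and d: "\<eta> \<le> t y - t x" for x y
    proof -
      define i where "i = nat \<lceil>t x / \<eta>\<rceil>"
      have "0 < t x" using t01 xy D by blast
      then have "0 < t x / \<eta>" using \<eta>pos by simp
      then have i: "t x / \<eta> \<le> real i" "real i < t x / \<eta> + 1" unfolding i_def by linarith+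
      define c where "c = real i * \<eta>"
      have c: "t x \<le> c" "c \<le> t y"
        using i \<eta>pos d unfolding c_def by (auto simp: field_simps)
      define h where "h z = cr ?r z - c * cr z ?e" for z
      have tc: "t z = c" if "h z = 0" "z \<in> ?D" for z
        using that den(1)[of z] D unfolding h_def t_def by (auto simp: field_simps subset_iff)
      have hx: "h x \<le> 0" and hy: "0 \<le> h y"
        using c den(1)[of x] den(1)[of y] xy D unfolding h_def t_def by (auto simp: field_simps subset_iff)
      show ?thesis
      proof (cases "h x = 0 \<or> h y = 0")
        case True
        then show ?thesis using tc xy unfolding c_def by blast
      next
        case False
        let ?z = "of_real (h y) * x + of_real (- h x) * y"
        have zD: "?z \<in> ?D"
          using False hx hy by (intro validD(7)[OF vu] xy) auto
        have "h ?z = h y * h x + (- h x) * h y"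
          unfolding h_def[of "_ + _"] cr_add cr_scale unfolding h_def by (simp add: algebra_simps)
        then have "t ?z = c" using tc zD by simp
        then show ?thesis using zD unfolding c_def by blast
      qed
    qed
    show ?thesis
      using gen[of x y] gen[of y x] xy dist by (cases "t x \<le> t y") auto
  qed
  define N where "N = {u. length u = k \<and> \<not> thin R \<delta> (dirs (run u s0))}"
  define ix where "ix u = (SOME i. \<exists>z\<in>dirs (run u s0). t z = real i * \<eta>)" for u
  have ix: "\<exists>z\<in>dirs (run u s0). t z = real (ix u) * \<eta>" if "u \<in> N" for u
    using someI_ex[OF ex[of u]] that unfolding ix_def N_def by blast
  have "inj_on ix N"
  proof (rule inj_onI)
    fix u v'
    assume uv: "u \<in> N" "v' \<in> N" "ix u = ix v'"
    obtain z z' where z: "z \<in> dirs (run u s0)" "z' \<in> dirs (run v' s0)" "t z = t z'"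
      using ix[OF uv(1)] ix[OF uv(2)] uv(3) by auto
    have D: "z \<in> dirs s0" "z' \<in> dirs s0" using z dirs_run_subset by blast+
    have "cr z z' = 0" using cr_t[OF D] z(3) K by simp
    then obtain \<kappa> where "0 < \<kappa>" "z' = of_real \<kappa> * z"
      using cr_eq_0_imp_pos_multiple den(1) D by blast
    then have "z' \<in> dirs (run u s0)" using dirs_scale[OF valid_run[OF v] z(1)] by simp
    then show "u = v'" using run_dirs_disjoint[of u v' z' s0] uv z unfolding N_def by simp
  qed
  moreover have "ix ` N \<subseteq> {1..nat \<lfloor>1 / \<eta>\<rfloor>}"
  proof (rule image_subsetI)
    fix u assume "u \<in> N"
    then obtain z where "z \<in> dirs (run u s0)" and tz: "t z = real (ix u) * \<eta>" using ix by blast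
    then have "z \<in> dirs s0" using dirs_run_subset by blast
    from t01[OF this] have "0 < real (ix u) * \<eta>" "real (ix u) * \<eta> < 1" unfolding tz .
    then have "0 < ix u" "real (ix u) < 1 / \<eta>" using \<eta>pos by (auto simp: zero_less_mult_iff field_simps)
    then show "ix u \<in> {1..nat \<lfloor>1 / \<eta>\<rfloor>}" by (simp add: le_nat_floor)
  qed
  ultimately have "card N \<le> card {1..nat \<lfloor>1 / \<eta>\<rfloor>}" by (intro card_inj_on_le) auto
  then have "card N \<le> nat \<lfloor>1 / \<eta>\<rfloor>" by simp
  then have "real (card N) \<le> real (nat \<lfloor>1 / \<eta>\<rfloor>)" by simp
  also have "\<dots> \<le> 1 / \<eta>" using \<eta>pos by (intro of_nat_floor) simp
  finally show ?thesis unfolding N_def .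
qed

text \<open>Sort the beams at level \<open>k\<close>: a thin one has at most
  \<open>2 * m + 1\<close> descendants after \<open>m\<close> more steps, any other at most
  \<open>2 ^ m\<close>, and \<open>card_not_thin_le\<close> bounds how many others there
  are.\<close>

lemma beam_count_window:
  assumes v: "valid V s0" and \<delta>: "0 < \<delta>" and K: "K = cr (end_pt s0 False) (end_pt s0 True)" "0 < K"
    and diam: "\<And>x y. x \<in> V \<Longrightarrow> y \<in> V \<Longrightarrow> norm (x - y) \<le> \<Delta>"
    and B: "norm (end_pt s0 True) \<le> B" "norm (end_pt s0 False) \<le> B" "norm (tip s0) \<le> B"
    and gap: "\<And>x y z. \<lbrakk>x \<in> reflected_pts V m; y \<in> reflected_pts V m; z \<in> reflected_pts V m\<rbrakk> \<Longrightarrow>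
      orient x y z = 0 \<or> \<delta> \<le> \<bar>orient x y z\<bar>"
    and R: "0 < R" "B + real (k + m) * \<Delta> \<le> R"
  shows "real (beam_count (k + m) s0) \<le> real (2 * m + 1) * real (beam_count k s0)
     + 2 ^ m * (3 * (R * \<Delta>)\<^sup>2 / (\<delta> * K))"
proof -
  let ?W = "{u :: bool list. length u = k}"
  let ?T = "{u \<in> ?W. \<not> thin R \<delta> (dirs (run u s0))}"
  let ?A = "{u \<in> ?W. dirs (run u s0) \<noteq> {}}"
  have fin: "finite ?W" by (rule finite_bool_lists)
  have \<Delta>0: "0 \<le> \<Delta>"
    using diam[of "opp s0" "opp s0"] validD(2)[OF v, of True] by auto
  have bc: "beam_count m (run u s0) \<le> (if dirs (run u s0) \<noteq> {} then 2 * m + 1 else 0) +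
      (if \<not> thin R \<delta> (dirs (run u s0)) then 2 ^ m else 0)" if u: "u \<in> ?W" for u
  proof -
    consider "dirs (run u s0) = {}" | "\<not> thin R \<delta> (dirs (run u s0))" |
      "thin R \<delta> (dirs (run u s0))" "dirs (run u s0) \<noteq> {}" by blast
    then show ?thesis
    proof cases
      case 1
      then show ?thesis using beam_count_empty[OF 1] by simp
    next
      case 2
      then show ?thesis using beam_count_le_power[of m "run u s0"] by simp
    next
      case 3
      have "collinear_splits (run u s0) m"
      proof (rule collinear_splits_thin[OF valid_run[OF v] 3(1) gap])
        fix w :: "bool list" assume w: "length w \<le> m"
        have "norm (tip (run (u @ w) s0)) \<le> B + real (length (u @ w)) * \<Delta>"
          by (rule norm_run_le[OF v diam B])
        also have "\<dots> \<le> B + real (k + m) * \<Delta>"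
          using u w \<Delta>0 by (intro add_left_mono mult_right_mono) auto
        finally show "norm (tip (run w (run u s0))) \<le> R"
          using R(2) by (simp add: run_append)
      qed
      then show ?thesis using beam_count_collinear[OF valid_run[OF v]] 3 by simp
    qed
  qed
  have "beam_count (k + m) s0 \<le> (\<Sum>u\<in>?W. (if dirs (run u s0) \<noteq> {} then 2 * m + 1 else 0) +
      (if \<not> thin R \<delta> (dirs (run u s0)) then 2 ^ m else 0))"
    unfolding beam_count_add by (intro sum_mono bc)
  also have "\<dots> = (2 * m + 1) * card ?A + 2 ^ m * card ?T"
    unfolding sum.distrib sum.inter_filter[OF fin, symmetric] by simp
  finally have "beam_count (k + m) s0 \<le> (2 * m + 1) * beam_count k s0 + 2 ^ m * card ?T"
    by (simp add: beam_count_eq_card)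
  then have "real (beam_count (k + m) s0) \<le> real ((2 * m + 1) * beam_count k s0 + 2 ^ m * card ?T)"
    by (rule of_nat_mono)
  moreover have "real (card ?T) \<le> 3 * (R * \<Delta>)\<^sup>2 / (\<delta> * K)"
  proof -
    let ?e = "norm (end_pt s0 True - end_pt s0 False)"
    have "real (card ?T) \<le> 1 / (\<delta> * K / (3 * (R * ?e)\<^sup>2))"
      using card_not_thin_le[OF v R(1) \<delta> K refl, of k] by simp
    also have "\<dots> = 3 * (R * ?e)\<^sup>2 / (\<delta> * K)" by simp
    also have "\<dots> \<le> 3 * (R * \<Delta>)\<^sup>2 / (\<delta> * K)"
    proof -
      have "?e \<le> \<Delta>"
        unfolding end_pt_def motion_dist[OF validD(1)[OF v]]
        using validD(2)[OF v, of True] by (intro diam) auto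
      then have "(R * ?e)\<^sup>2 \<le> (R * \<Delta>)\<^sup>2" using R by (intro power_mono mult_left_mono) auto
      then show ?thesis using \<delta> K by (intro divide_right_mono) auto
    qed
    finally show ?thesis .
  qed
  then have "2 ^ m * real (card ?T) \<le> 2 ^ m * (3 * (R * \<Delta>)\<^sup>2 / (\<delta> * K))" by (intro mult_left_mono) auto
  moreover have "real ((2 * m + 1) * beam_count k s0 + 2 ^ m * card ?T)
      = real (2 * m + 1) * real (beam_count k s0) + 2 ^ m * real (card ?T)"
    by (simp only: of_nat_add of_nat_mult of_nat_power of_nat_numeral)
  ultimately show ?thesis by linarith
qed

section \<open>Codes of generalized diagonals\<close>

lemma orient_affine:
  "orient a b (of_real (1 - t) * x + of_real t * y) = (1 - t) * orient a b x + t * orient a b y"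
  by (simp add: orient_def cr_def algebra_simps)

lemma in_open_segment_complex:
  assumes "x \<in> open_segment a b"
  obtains t where "0 < t" "t < 1" "x = of_real (1 - t) * a + of_real t * b"
  using assms by (auto simp: in_segment scaleR_conv_of_real)

lemma orient_open_segment:
  assumes "x \<in> open_segment p q" "orient a b p = 0" "orient a b q = 0"
  shows "orient a b x = 0"
proof -
  obtain t where t: "x = of_real (1 - t) * p + of_real t * q"
    using assms(1) by (elim in_open_segment_complex)
  show ?thesis unfolding t orient_affine using assms(2,3) by simp
qed

lemma orient_on_side: "x \<in> open_segment a b \<Longrightarrow> orient a b x = 0"
  by (rule orient_open_segment[where p = a and q = b]) (simp_all add: orient_degenerate)

lemma not_collinear_if_orient:
  assumes "orient a b c \<noteq> 0"
  shows "\<not> collinear {a, b, c}"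
proof
  assume "collinear {a, b, c}"
  then have "collinear {b, a, c}" by (simp add: insert_commute)
  then have "collinear {0, b - a, c - a}" by (subst (asm) collinear_3) (simp add: NO_MATCH_def)
  then show False
    using assms unfolding collinear_lemma orient_def scaleR_conv_of_real
    by (auto simp: cr_scale cr_self cr_def[of 0] cr_def[of _ 0])
qed

text \<open>The signed area over the side is the barycentric weight of \<open>c\<close>, which is
  positive at interior points, times the area of the whole triangle.\<close>

lemma orient_interior_hull:
  assumes V: "V = {a, b, c}" and o: "orient a b c \<noteq> 0" and x: "x \<in> interior (convex hull V)"
  shows "orient a b x \<noteq> 0"
proof -
  obtain p q r where pqr: "0 < p" "0 < q" "0 < r" "p + q + r = 1" "p *\<^sub>R a + q *\<^sub>R b + r *\<^sub>R c = x"
    using x interior_convex_hull_3_minimal[OF not_collinear_if_orient[OF o]] unfolding V by auto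
  have p: "p = 1 - q - r" using pqr(4) by simp
  have "x - a = of_real q * (b - a) + of_real r * (c - a)"
    unfolding pqr(5)[symmetric] p by (simp add: scaleR_conv_of_real algebra_simps)
  then have "orient a b x = r * orient a b c"
    unfolding orient_def by (simp only: cr_add cr_scale cr_self)
  then show ?thesis using pqr(3) o by simp
qed

text \<open>Otherwise the midpoint would be an interior point on the line of a side. Hence a
  billiard path never meets the same side twice in succession.\<close>

lemma segment_leaves_line:
  assumes V: "V = {a, b, c}" and o: "orient a b c \<noteq> 0"
    and pq: "p \<noteq> q" "open_segment p q \<subseteq> interior (convex hull V)" and p: "orient a b p = 0"
  shows "orient a b q \<noteq> 0"
proof
  assume q: "orient a b q = 0"
  have "midpoint p q \<in> open_segment p q" using pq(1) by simp
  then show False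
    using orient_interior_hull[OF V o, of "midpoint p q"] pq(2) orient_open_segment[OF _ p q] by blast
qed

lemma reflect_affine:
  "reflect a b (of_real (1 - t) * x + of_real t * y) = of_real (1 - t) * reflect a b x + of_real t * reflect a b y"
proof -
  define u where "u = (b - a) / cnj (b - a)"
  show ?thesis unfolding reflect_def u_def[symmetric] by (simp add: algebra_simps)
qed

lemma reflect_open_segment:
  assumes "a \<noteq> b" "x \<in> open_segment a b"
  shows "reflect a b x = x"
proof -
  obtain t where t: "x = of_real (1 - t) * a + of_real t * b"
    using assms(2) by (elim in_open_segment_complex)
  show ?thesis unfolding t reflect_affine reflect_fixes(1) reflect_fixes(2)[OF assms(1)] ..
qed

lemma refl_dir_eq: "refl_dir w d = w / cnj w * cnj d"
proof (cases "w = 0")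
  case False
  have "complex_of_real ((norm w)\<^sup>2) = w * cnj w" by (rule complex_norm_square)
  then have "refl_dir w d = w ^ 2 / (w * cnj w) * cnj d" unfolding refl_dir_def by simp
  also have "w ^ 2 / (w * cnj w) = w / cnj w" using False by (simp add: power2_eq_square)
  finally show ?thesis .
qed (simp add: refl_dir_def)

lemma refl_dir_minus: "refl_dir (- w) d = refl_dir w d"
  by (simp add: refl_dir_eq)

lemma refl_dir_of_real: "refl_dir w (of_real c * d) = of_real c * refl_dir w d"
  by (simp add: refl_dir_eq)

lemma refl_dir_involution: "w \<noteq> 0 \<Longrightarrow> refl_dir w (refl_dir w d) = d"
  by (simp add: refl_dir_eq)

lemma reflect_diff: "reflect a b x - reflect a b y = refl_dir (b - a) (x - y)"
proof -
  define u where "u = (b - a) / cnj (b - a)"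
  show ?thesis unfolding reflect_def refl_dir_eq u_def[symmetric] by (simp add: algebra_simps)
qed

lemma motion_scale_diff:
  assumes "motion g" "x - y = of_real c * (x' - y')"
  shows "g x - g y = of_real c * (g x' - g y')"
proof -
  obtain u t where "g = (\<lambda>z. u * z + t) \<or> g = (\<lambda>z. u * cnj z + t)"
    using assms(1) unfolding motion_def by blast
  then show ?thesis
  proof
    assume g: "g = (\<lambda>z. u * z + t)"
    then have "g z - g w = u * (z - w)" for z w by (simp add: algebra_simps)
    then show ?thesis using assms(2) by simp
  next
    assume g: "g = (\<lambda>z. u * cnj z + t)"
    have diff: "g z - g w = u * cnj (z - w)" for z w unfolding g by (simp add: algebra_simps)
    show ?thesis unfolding diff assms(2) by simp
  qed
qed

text \<open>The first reflection is already carried out: a path leaving the vertex \<open>a\<close>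
  can only hit the opposite side, so this side counts as crossed and the opposite vertex of the new
  copy is again \<open>a\<close>.\<close>

definition start_beam :: "complex \<Rightarrow> complex \<Rightarrow> complex \<Rightarrow> beam" where
  "start_beam a r l = Beam (\<lambda>z. reflect r l z - a) (\<lambda>b. if b then l else r) a
     {d. 0 < cr (r - a) d \<and> 0 < cr d (l - a)}"

locale triangle =
  fixes V :: "complex set" and a r l :: complex
  assumes V: "V = {a, r, l}" and pos: "0 < orient a r l"
begin

definition s0 :: beam where "s0 = start_beam a r l"

lemma distinct: "a \<noteq> r" "a \<noteq> l" "r \<noteq> l"
  using pos by (auto simp: orient_degenerate)

lemma end_pt_s0: "end_pt s0 True = l - a" "end_pt s0 False = r - a"
  using distinct unfolding s0_def start_beam_def end_pt_def by (simp_all add: reflect_fixes)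

lemma cr_pos: "0 < cr (r - a) (l - a)"
  using pos unfolding orient_def .

lemma valid_s0: "valid V s0"
proof -
  have "motion ((\<lambda>z. z - a) \<circ> reflect r l)"
  proof (intro motion_comp motion_reflect distinct)
    show "motion (\<lambda>z. z - a)" unfolding motion_def by (intro exI[of _ 1] exI[of _ "- a"]) simp
  qed
  then have 1: "motion (frame s0)" unfolding s0_def start_beam_def by (simp add: o_def)
  have tr: "orient (x - a) (y - a) (z - a) = orient x y z" for x y z
    by (simp add: orient_def)
  have "orient r a l = - orient a r l" by (rule orient_perm)
  then have 2: "0 < orient (end_pt s0 False) (tip s0) (end_pt s0 True)"
    using pos reflect_orient[OF distinct(3), of r a l]
    unfolding s0_def start_beam_def end_pt_def tip_def by (simp add: tr)
  have d: "dirs s0 = {d. 0 < cr (r - a) d \<and> 0 < cr d (l - a)}"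
    unfolding s0_def start_beam_def by simp
  show ?thesis
    unfolding valid_def
  proof (intro conjI ballI allI impI)
    show "{side s0 False, side s0 True, opp s0} = V"
      unfolding s0_def start_beam_def V by auto
  qed (use 1 2 cr_pos in \<open>auto simp: d end_pt_s0 cr_add cr_scale add_pos_pos simp del: of_real_add\<close>)
qed

definition point_coded :: "complex \<Rightarrow> beam \<Rightarrow> complex \<Rightarrow> bool" where
  "point_coded d s p \<longleftrightarrow> d \<in> dirs s \<and> p \<in> open_segment (side s False) (side s True) \<and>
     (\<exists>\<tau>>0. frame s p = of_real \<tau> * d)"

text \<open>The offset 3 counts the starting vertex, the reflection in the side opposite to it,
  which the code does not record, and the final vertex.\<close>

definition coded :: "bool list \<Rightarrow> complex list \<Rightarrow> bool" where
  "coded u ps \<longleftrightarrow> length ps = length u + 3 \<and> hd ps = a \<and> last ps = opp (run u s0) \<and> splits (run u s0) \<and>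
     (\<exists>d. (\<forall>j\<le>length u. point_coded d (run (take j u) s0) (ps ! (j + 1))) \<and>
        (\<exists>\<tau>>0. tip (run u s0) = of_real \<tau> * d))"

lemma orient_side:
  assumes "valid V s"
  shows "orient (side s False) (side s True) (opp s) \<noteq> 0"
proof -
  obtain e where e: "\<And>x y z. orient (frame s x) (frame s y) (frame s z) = e * orient x y z"
    using motion_orient[OF validD(1)[OF assms]] by blast
  have "orient (end_pt s False) (tip s) (end_pt s True) \<noteq> 0"
    using assms unfolding valid_def by auto
  then show ?thesis
    unfolding end_pt_def tip_def e using orient_perm(1)[of "side s False" "opp s" "side s True"] by auto
qed

text \<open>The unfolded point is where a ray meets a line transversal to it. Directions are
  compared only up to a positive factor, because that is all that the tip determines.\<close>

lemma point_coded_unique: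
  assumes v: "valid V s" and p: "point_coded d s p" "point_coded d' s p'"
    and d': "d' = of_real k * d" "0 < k"
  shows "p = p'"
proof -
  let ?L = "end_pt s True" and ?R = "end_pt s False"
  have line: "cr (frame s x) (?L - ?R) = cr ?R ?L" if x: "x \<in> open_segment (side s False) (side s True)" for x
  proof -
    obtain t where "x = of_real (1 - t) * side s False + of_real t * side s True"
      using x by (elim in_open_segment_complex)
    then have "frame s x = of_real (1 - t) * ?R + of_real t * ?L"
      unfolding end_pt_def by (simp only: motion_affine[OF validD(1)[OF v]])
    then show ?thesis
      using cr_swap[of ?L ?R] by (simp only: cr_add cr_scale cr_diff cr_self) (simp add: algebra_simps)
  qed
  obtain \<tau> where \<tau>: "frame s p = of_real \<tau> * d" using p unfolding point_coded_def by blast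
  obtain \<tau>' where \<tau>': "frame s p' = of_real \<tau>' * d'" using p unfolding point_coded_def by blast
  have "d \<in> dirs s" using p unfolding point_coded_def by blast
  from crs_side_pos[OF v this, of True] have pos: "0 < cr d (?L - ?R)" by (simp add: crs_def)
  have "\<tau> * cr d (?L - ?R) = (\<tau>' * k) * cr d (?L - ?R)"
    using line[of p] line[of p'] p unfolding \<tau> \<tau>' d' point_coded_def cr_scale by simp
  then have "\<tau> = \<tau>' * k" using pos by simp
  then have "frame s p = frame s p'" unfolding \<tau> \<tau>' d' by simp
  then show ?thesis by (rule motion_inj[OF validD(1)[OF v]])
qed

text \<open>The code determines the tip, the tip determines the ray from the origin, and the ray
  determines every reflection point.\<close>

lemma coded_unique:
  assumes "coded u ps" "coded u ps'"
  shows "ps = ps'"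
proof -
  obtain d \<tau> where d: "\<And>j. j \<le> length u \<Longrightarrow> point_coded d (run (take j u) s0) (ps ! (j + 1))"
    "0 < \<tau>" "tip (run u s0) = of_real \<tau> * d" using assms(1) unfolding coded_def by blast
  obtain d' \<tau>' where d': "\<And>j. j \<le> length u \<Longrightarrow> point_coded d' (run (take j u) s0) (ps' ! (j + 1))"
    "0 < \<tau>'" "tip (run u s0) = of_real \<tau>' * d'" using assms(2) unfolding coded_def by blast
  have eq: "d' = of_real (\<tau> / \<tau>') * d" "0 < \<tau> / \<tau>'"
    using d(2,3) d'(2,3) by (auto simp: field_simps)
  have len: "length ps = length u + 3" "length ps' = length u + 3"
    using assms unfolding coded_def by auto
  show ?thesis
  proof (rule nth_equalityI)
    fix i assume i: "i < length ps"
    have "i = 0 \<or> i = length u + 2 \<or> i = (i - 1) + 1 \<and> i - 1 \<le> length u"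
      using i len by auto
    then consider "i = 0" | "i = length u + 2" | j where "i = j + 1" "j \<le> length u"
      by blast
    then show "ps ! i = ps' ! i"
    proof cases
      case 1
      have "ps \<noteq> []" "ps' \<noteq> []" using len by auto
      then show ?thesis using 1 assms unfolding coded_def by (simp add: hd_conv_nth)
    next
      case 2
      have "ps \<noteq> []" "ps' \<noteq> []" using len by auto
      then have "last ps = ps ! i" "last ps' = ps' ! i" using len 2 by (simp_all add: last_conv_nth)
      then show ?thesis using assms unfolding coded_def by simp
    next
      case 3
      show ?thesis unfolding 3(1)
        by (rule point_coded_unique[OF valid_run[OF valid_s0] d(1)[OF 3(2)] d'(1)[OF 3(2)] eq])
    qed
  qed (simp add: len)
qed

text \<open>Unfolding straightens the path: each new frame undoes the mirror law, so in frame
  coordinates all pieces point in the initial direction \<open>ps ! 1 - a\<close>. The induction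
  carries the direction of the next piece along with the code.\<close>

lemma gen_diag_coded_prefix:
  assumes gd: "is_gen_diag V ps" and hd: "hd ps = a" and i: "i + 2 < length ps"
  shows "\<exists>u. length u = i \<and> (\<forall>j\<le>i. point_coded (ps ! 1 - a) (run (take j u) s0) (ps ! (j + 1))) \<and>
     (\<exists>c>0. frame (run u s0) (ps ! (i + 2)) - frame (run u s0) (ps ! (i + 1)) = of_real c * (ps ! 1 - a))"
  using i
proof (induction i)
  case 0
  let ?d = "ps ! 1 - a" and ?p = "ps ! 1"
  have h0: "ps ! 0 = a" using hd 0 hd_conv_nth[of ps] by fastforce
  have seg: "a \<noteq> ?p" "open_segment a ?p \<subseteq> interior (convex hull V)"
    using gd 0 h0 unfolding is_gen_diag_def by (auto dest: spec[of _ 0])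
  obtain x y c where xy: "x \<in> V" "y \<in> V" "x \<noteq> y" "?p \<in> open_segment x y" "0 < c"
    "ps ! 2 - ?p = of_real c * refl_dir (y - x) ?d"
    using gd 0 h0 unfolding is_gen_diag_def by (auto dest!: spec[of _ 1] simp: numeral_2_eq_2)
  have o1: "orient a r l \<noteq> 0" "orient a l r \<noteq> 0" using pos orient_perm(1)[of a r l] by auto
  have "orient a r ?p \<noteq> 0" "orient a l ?p \<noteq> 0"
    by (rule segment_leaves_line[OF V o1(1) seg], simp add: orient_degenerate)
       (rule segment_leaves_line[OF _ o1(2) seg], auto simp: V orient_degenerate)
  then have "{x, y} = {r, l}"
    using xy(1-4) orient_on_side[of ?p] unfolding V by (auto simp: open_segment_commute)
  then have p: "?p \<in> open_segment r l" and rd: "refl_dir (y - x) = refl_dir (l - r)"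
    using xy(4) refl_dir_minus[of "y - x"] by (auto simp: doubleton_eq_iff open_segment_commute fun_eq_iff)
  have fr: "frame s0 ?p = ?d"
    unfolding s0_def start_beam_def using reflect_open_segment[OF distinct(3) p] by simp
  obtain t where t: "0 < t" "t < 1" "?p = of_real (1 - t) * r + of_real t * l"
    using p by (elim in_open_segment_complex)
  have "?d = of_real (1 - t) * (r - a) + of_real t * (l - a)" unfolding t(3) by (simp add: algebra_simps)
  then have "?d \<in> dirs s0"
    using t cr_pos unfolding s0_def start_beam_def by (simp only: beam.sel mem_Collect_eq cr_add cr_scale cr_self) simp
  then have "point_coded ?d s0 ?p"
    unfolding point_coded_def using p fr by (auto simp: s0_def start_beam_def intro!: exI[of _ 1])
  moreover have "frame s0 (ps ! 2) - frame s0 ?p = of_real c * ?d"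
  proof -
    have "frame s0 (ps ! 2) - frame s0 ?p = refl_dir (l - r) (ps ! 2 - ?p)"
      unfolding s0_def start_beam_def by (simp add: reflect_diff)
    also have "\<dots> = of_real c * ?d"
      unfolding xy(6) rd refl_dir_of_real using distinct(3) by (simp add: refl_dir_involution)
    finally show ?thesis .
  qed
  ultimately show ?case using xy(5) by (intro exI[of _ "[]"]) (auto simp: numeral_2_eq_2)
next
  case (Suc i)
  let ?d = "ps ! 1 - a"
  obtain u c where u: "length u = i" "\<And>j. j \<le> i \<Longrightarrow> point_coded ?d (run (take j u) s0) (ps ! (j + 1))"
    and c: "0 < c" "frame (run u s0) (ps ! (i + 2)) - frame (run u s0) (ps ! (i + 1)) = of_real c * ?d"
    using Suc by (auto simp del: add_2_eq_Suc')
  define s where "s = run u s0"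
  define p q where "p = ps ! (i + 1)" and "q = ps ! (i + 2)"
  have v: "valid V s" unfolding s_def by (rule valid_run[OF valid_s0])
  have pc: "point_coded ?d s p" using u(2)[of i] u(1) unfolding s_def p_def by simp
  then obtain \<tau> where \<tau>: "0 < \<tau>" "frame s p = of_real \<tau> * ?d"
    and d: "?d \<in> dirs s" and p: "p \<in> open_segment (side s False) (side s True)"
    unfolding point_coded_def by blast
  have fq: "frame s q = of_real (\<tau> + c) * ?d"
    using c(2) \<tau>(2) unfolding s_def[symmetric] p_def[symmetric] q_def[symmetric]
    by (simp add: algebra_simps)
  have seg: "p \<noteq> q" "open_segment p q \<subseteq> interior (convex hull V)"
    using gd Suc.prems unfolding is_gen_diag_def p_def q_def by (auto dest!: spec[of _ "i + 1"])
  obtain x y c' where xy: "x \<in> V" "y \<in> V" "x \<noteq> y" "q \<in> open_segment x y" "0 < c'"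
    "ps ! (i + 3) - q = of_real c' * refl_dir (y - x) (q - p)"
    using gd Suc.prems unfolding is_gen_diag_def p_def q_def
    by (auto dest!: spec[of _ "i + 2"] simp: numeral_3_eq_3)
  have "orient (side s False) (side s True) q \<noteq> 0"
    by (rule segment_leaves_line[OF _ orient_side[OF v] seg orient_on_side[OF p]])
       (use validD(2)[OF v, of False] in auto)
  then have "\<not> {x, y} = {side s False, side s True}"
    using xy(4) orient_on_side[of q] by (auto simp: doubleton_eq_iff open_segment_commute)
  moreover have "x \<in> {side s False, side s True, opp s}" "y \<in> {side s False, side s True, opp s}"
    using xy validD(2)[OF v, of False] by auto
  ultimately have "{x, y} = {side s False, opp s} \<or> {x, y} = {side s True, opp s}"
    using xy(3) by (auto simp: doubleton_eq_iff)
  then obtain b where b: "{x, y} = {side s b, opp s}" by blast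
  have q: "q \<in> open_segment (side s b) (opp s)" and rd: "refl_dir (y - x) = refl_dir (opp s - side s b)"
    using b xy(4) refl_dir_minus[of "y - x"] by (auto simp: doubleton_eq_iff open_segment_commute fun_eq_iff)
  let ?\<sigma> = "reflect (side s b) (opp s)" and ?s = "step b s"
  note ds = valid_distinct(1)[OF v, of b]
  obtain t where t: "0 < t" "t < 1" "q = of_real (1 - t) * opp s + of_real t * side s b"
    using q unfolding open_segment_commute[of "side s b"] by (elim in_open_segment_complex)
  have fq2: "frame s q = of_real (1 - t) * tip s + of_real t * end_pt s b"
    unfolding t(3) tip_def end_pt_def by (rule motion_affine[OF validD(1)[OF v]])
  \<comment> \<open>The next hit \<open>q\<close> lies strictly between the tip and the kept end
    point, so the ray passes the tip on the side of that end point.\<close>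
  have dT: "0 < crs b (tip s) ?d"
  proof -
    have "0 < (\<tau> + c) * crs b ?d (end_pt s b)"
      using validD(6)[OF v d, of b] \<tau> c by simp
    also have "\<dots> = crs b (frame s q) (end_pt s b)" unfolding fq by (simp only: crs_linear)
    also have "\<dots> = (1 - t) * crs b (tip s) (end_pt s b)"
      unfolding fq2 by (simp only: crs_linear crs_self)
    finally have 1: "0 < crs b (tip s) (end_pt s b)" using t by (simp add: zero_less_mult_iff)
    have "(\<tau> + c) * crs b (tip s) ?d = crs b (tip s) (frame s q)" unfolding fq by (simp only: crs_linear)
    also have "\<dots> = t * crs b (tip s) (end_pt s b)"
      unfolding fq2 by (simp only: crs_linear crs_self)
    finally have "0 < (\<tau> + c) * crs b (tip s) ?d" using 1 t by simp
    then show ?thesis using \<tau> c by (simp add: zero_less_mult_iff)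
  qed
  have fs: "frame ?s z = frame s (?\<sigma> z)" for z by (simp add: step_def)
  have pc': "point_coded ?d ?s q"
    unfolding point_coded_def
  proof (intro conjI)
    show "?d \<in> dirs ?s" using d dT by (simp add: dirs_step)
    show "q \<in> open_segment (side ?s False) (side ?s True)"
      using q by (cases b) (simp_all add: step_def open_segment_commute)
    show "\<exists>\<tau>>0. frame ?s q = of_real \<tau> * ?d"
      using fq \<tau> c reflect_open_segment[OF ds q] unfolding fs by (intro exI[of _ "\<tau> + c"]) simp
  qed
  \<comment> \<open>Reflecting in the side just hit turns the outgoing direction back into the
    incoming one.\<close>
  have out: "frame ?s (ps ! (i + 3)) - frame ?s q = of_real (c' * c) * ?d"
  proof -
    have "?\<sigma> (ps ! (i + 3)) - ?\<sigma> q = of_real c' * (q - p)"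
      unfolding reflect_diff xy(6) rd refl_dir_of_real using ds by (simp add: refl_dir_involution)
    then have "frame ?s (ps ! (i + 3)) - frame ?s q = of_real c' * (frame s q - frame s p)"
      unfolding fs by (rule motion_scale_diff[OF validD(1)[OF v]])
    then show ?thesis using c(2) unfolding s_def p_def q_def by simp
  qed
  have run': "run (u @ [b]) s0 = ?s" unfolding s_def by (simp add: run_append)
  show ?case
  proof (intro exI[of _ "u @ [b]"] conjI allI impI)
    show "length (u @ [b]) = Suc i" using u by simp
    show "point_coded ?d (run (take j (u @ [b])) s0) (ps ! (j + 1))" if "j \<le> Suc i" for j
    proof (cases "j \<le> i")
      case True
      then show ?thesis using u by simp
    next
      case False
      with that have "j = Suc i" by simp
      then show ?thesis using pc' u(1) run' unfolding q_def by simp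
    qed
    show "\<exists>c>0. frame (run (u @ [b]) s0) (ps ! (Suc i + 2)) - frame (run (u @ [b]) s0) (ps ! (Suc i + 1)) =
        of_real c * ?d"
      unfolding run' using out xy(5) c(1) unfolding q_def
      by (intro exI[of _ "c' * c"]) (simp add: numeral_3_eq_3 numeral_2_eq_2)
  qed
qed

lemma gen_diag_coded:
  assumes gd: "is_gen_diag V ps" and hd: "hd ps = a"
  shows "\<exists>u. coded u ps"
proof -
  have len: "2 \<le> length ps" using gd unfolding is_gen_diag_def by simp
  have lastV: "ps ! (length ps - 1) \<in> V"
    using gd len last_conv_nth[of ps] unfolding is_gen_diag_def by fastforce
  have h0: "ps ! 0 = a" using hd len hd_conv_nth[of ps] by fastforce
  have o1: "orient a r l \<noteq> 0" "orient a l r \<noteq> 0" using pos orient_perm(1)[of a r l] by auto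
  \<comment> \<open>No diagonal is free of reflections: a segment from \<open>a\<close> to another
    vertex is a side and does not run through the interior.\<close>
  have "length ps \<noteq> 2"
  proof
    assume l2: "length ps = 2"
    then have seg: "a \<noteq> ps ! 1" "open_segment a (ps ! 1) \<subseteq> interior (convex hull V)"
      using gd h0 unfolding is_gen_diag_def by (auto dest: spec[of _ 0])
    have "orient a r (ps ! 1) \<noteq> 0" "orient a l (ps ! 1) \<noteq> 0"
      by (rule segment_leaves_line[OF V o1(1) seg], simp add: orient_degenerate)
         (rule segment_leaves_line[OF _ o1(2) seg], auto simp: V orient_degenerate)
    then show False using lastV l2 unfolding V by (auto simp: orient_degenerate)
  qed
  with len have "length ps = (length ps - 3) + 3" by simp
  then obtain i where i: "length ps = i + 3" by blast
  let ?d = "ps ! 1 - a"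
  obtain u c where u: "length u = i" "\<And>j. j \<le> i \<Longrightarrow> point_coded ?d (run (take j u) s0) (ps ! (j + 1))"
    and c: "0 < c" "frame (run u s0) (ps ! (i + 2)) - frame (run u s0) (ps ! (i + 1)) = of_real c * ?d"
    using gen_diag_coded_prefix[OF gd hd, of i] i by (auto simp del: add_2_eq_Suc')
  define s where "s = run u s0"
  define p q where "p = ps ! (i + 1)" and "q = ps ! (i + 2)"
  have v: "valid V s" unfolding s_def by (rule valid_run[OF valid_s0])
  have pc: "point_coded ?d s p" using u(2)[of i] u(1) unfolding s_def p_def by simp
  then obtain \<tau> where \<tau>: "0 < \<tau>" "frame s p = of_real \<tau> * ?d"
    and d: "?d \<in> dirs s" and p: "p \<in> open_segment (side s False) (side s True)"
    unfolding point_coded_def by blast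
  have fq: "frame s q = of_real (\<tau> + c) * ?d"
    using c(2) \<tau>(2) unfolding s_def[symmetric] p_def[symmetric] q_def[symmetric]
    by (simp add: algebra_simps)
  have seg: "p \<noteq> q" "open_segment p q \<subseteq> interior (convex hull V)"
    using gd i unfolding is_gen_diag_def p_def q_def by (auto dest!: spec[of _ "i + 1"])
  have "orient (side s False) (side s True) q \<noteq> 0"
    by (rule segment_leaves_line[OF _ orient_side[OF v] seg orient_on_side[OF p]])
       (use validD(2)[OF v, of False] in auto)
  moreover have "q \<in> {side s False, side s True, opp s}"
    using lastV i validD(2)[OF v, of False] unfolding q_def by auto
  ultimately have q: "q = opp s" by (auto simp: orient_degenerate)
  have tip: "tip s = of_real (\<tau> + c) * ?d" using fq unfolding q tip_def .
  have "splits s"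
    unfolding splits_def tip using \<tau> c by (intro dirs_scale[OF v d]) simp
  moreover have "last ps = opp s"
    using q i last_conv_nth[of ps] unfolding q_def by fastforce
  ultimately have "coded u ps"
    unfolding coded_def s_def[symmetric] using u i hd tip \<tau> c
    by (auto intro!: exI[of _ ?d] exI[of _ "\<tau> + c"])
  then show ?thesis ..
qed

text \<open>A diagonal with a code of length \<open>k\<close> has \<open>k + 1\<close> reflections,
  hence the sum over \<open>k < n\<close>. A code with a diagonal belongs to a nonempty beam, since
  the tip lies in it.\<close>

lemma P_count_le: "P_count V a n \<le> (\<Sum>k<n. beam_count k s0)"
proof -
  let ?G = "{ps. is_gen_diag V ps \<and> hd ps = a \<and> length ps \<le> n + 2}"
  let ?W = "\<lambda>k. {u. length u = k \<and> dirs (run u s0) \<noteq> {}}"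
  define f where "f ps = (SOME u. coded u ps)" for ps
  have f: "coded (f ps) ps" if "ps \<in> ?G" for ps
    using someI_ex[OF gen_diag_coded[of ps]] that unfolding f_def by blast
  have "inj_on f ?G"
  proof (rule inj_onI)
    fix ps ps' assume "ps \<in> ?G" "ps' \<in> ?G" "f ps = f ps'"
    then show "ps = ps'" using coded_unique[OF f[of ps]] f[of ps'] by simp
  qed
  moreover have "f ` ?G \<subseteq> (\<Union>k<n. ?W k)"
  proof (rule image_subsetI)
    fix ps assume ps: "ps \<in> ?G"
    have "length ps = length (f ps) + 3" "splits (run (f ps) s0)"
      using f[OF ps] unfolding coded_def by auto
    then show "f ps \<in> (\<Union>k<n. ?W k)" using ps unfolding splits_def by auto
  qed
  moreover have fin: "finite (?W k)" for k
    using finite_bool_lists[of k] by (rule rev_finite_subset) auto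
  ultimately have "card ?G \<le> card (\<Union>k<n. ?W k)"
    by (intro card_inj_on_le) auto
  also have "\<dots> \<le> (\<Sum>k<n. card (?W k))" by (rule card_UN_le) simp
  finally show ?thesis
    unfolding P_count_def beam_count_eq_card .
qed

end

section \<open>Growth\<close>

context triangle
begin

definition perim :: real where "perim = norm (a - r) + norm (a - l) + norm (r - l)"

lemma perim_pos: "0 < perim"
  using distinct unfolding perim_def by (intro add_pos_pos) auto

lemma dist_le_perim: "x \<in> V \<Longrightarrow> y \<in> V \<Longrightarrow> norm (x - y) \<le> perim"
  unfolding V perim_def by (auto simp: norm_minus_commute)

lemma norm_s0:
  "norm (end_pt s0 True) \<le> 2 * perim" "norm (end_pt s0 False) \<le> 2 * perim" "norm (tip s0) \<le> 2 * perim"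
proof -
  have L: "norm (l - a) \<le> perim" and R: "norm (r - a) \<le> perim" and AR: "norm (a - r) \<le> perim"
    by (intro dist_le_perim; simp add: V)+
  show "norm (end_pt s0 True) \<le> 2 * perim" "norm (end_pt s0 False) \<le> 2 * perim"
    using L R perim_pos unfolding end_pt_s0 by auto
  have "norm (tip s0 - end_pt s0 False) = norm (opp s0 - side s0 False)"
    unfolding tip_def end_pt_def by (rule motion_dist[OF validD(1)[OF valid_s0]])
  also have "\<dots> \<le> perim" using AR by (simp add: s0_def start_beam_def)
  finally show "norm (tip s0) \<le> 2 * perim"
    using R norm_triangle_sub[of "tip s0" "end_pt s0 False"] unfolding end_pt_s0 by linarith
qed

text \<open>Iterates \<open>beam_count_window\<close> in steps of \<open>m\<close>. The radius
  \<open>(real n + 2) * perim\<close> serves all levels up to \<open>n\<close> simultaneously, which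
  makes the additive term \<open>2 ^ m * T\<close> independent of the level.\<close>

lemma beam_count_bound:
  assumes m: "0 < m" and \<delta>: "0 < \<delta>"
    and gap: "\<And>x y z. \<lbrakk>x \<in> reflected_pts V m; y \<in> reflected_pts V m; z \<in> reflected_pts V m\<rbrakk> \<Longrightarrow>
      orient x y z = 0 \<or> \<delta> \<le> \<bar>orient x y z\<bar>"
    and T: "T = 3 * ((real n + 2) * perim * perim)\<^sup>2 / (\<delta> * cr (r - a) (l - a))"
    and k: "k \<le> n"
  shows "real (beam_count k s0) \<le> 2 ^ m * (1 + T) * real (2 * m + 2) ^ (k div m)"
  using k
proof (induction k rule: less_induct)
  case (less k)
  have T0: "0 \<le> T" unfolding T using \<delta> cr_pos by (intro divide_nonneg_pos) auto
  let ?X = "2 ^ m * (1 + T)"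
  have X: "2 ^ m \<le> ?X" "2 ^ m * T \<le> ?X" using T0 by (simp_all add: algebra_simps)
  show ?case
  proof (cases "k < m")
    case True
    have "real (beam_count k s0) \<le> 2 ^ k"
      using beam_count_le_power[of k s0] by (metis of_nat_le_iff of_nat_numeral of_nat_power)
    also have "\<dots> \<le> 2 ^ m" using True by simp
    finally have "real (beam_count k s0) \<le> ?X" using X(1) by linarith
    then show ?thesis using True by simp
  next
    case False
    define j where "j = k - m"
    have k: "k = j + m" using False unfolding j_def by simp
    have kd: "k div m = Suc (j div m)" using m unfolding k by simp
    \<comment> \<open>Since the additive term is at most \<open>?Y\<close>, it is absorbed by
      raising the factor from \<open>2 * m + 1\<close> to \<open>2 * m + 2\<close>.\<close>
    let ?Y = "?X * real (2 * m + 2) ^ (j div m)"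
    have "real (beam_count k s0) \<le> real (2 * m + 1) * real (beam_count j s0) + 2 ^ m * T"
      unfolding k T
    proof (rule beam_count_window[OF valid_s0 \<delta> _ _ dist_le_perim norm_s0 gap, of _ _ "(real n + 2) * perim", unfolded end_pt_s0])
      show "2 * perim + real (j + m) * perim \<le> (real n + 2) * perim"
      proof -
        have "real (j + m) * perim \<le> real n * perim"
          using less.prems perim_pos unfolding k by (intro mult_right_mono) auto
        then show ?thesis unfolding distrib_right by linarith
      qed
      show "0 < (real n + 2) * perim" using perim_pos by (intro mult_pos_pos) auto
    qed (use cr_pos in auto)
    also have "\<dots> \<le> real (2 * m + 1) * ?Y + ?Y"
    proof (rule add_mono)
      show "real (2 * m + 1) * real (beam_count j s0) \<le> real (2 * m + 1) * ?Y"
        using less.IH[of j] less.prems m unfolding k by (intro mult_left_mono) auto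
      have "1 \<le> real (2 * m + 2) ^ (j div m)" by (rule one_le_power) simp
      then have "?X * 1 \<le> ?Y" using T0 by (intro mult_left_mono) auto
      then show "2 ^ m * T \<le> ?Y" using X(2) by linarith
    qed
    also have "\<dots> = ?X * real (2 * m + 2) ^ (k div m)"
      unfolding kd by (simp add: algebra_simps)
    finally show ?thesis .
  qed
qed

lemma P_count_cube_le:
  assumes m: "0 < m" and \<delta>: "0 < \<delta>"
    and gap: "\<And>x y z. \<lbrakk>x \<in> reflected_pts V m; y \<in> reflected_pts V m; z \<in> reflected_pts V m\<rbrakk> \<Longrightarrow>
      orient x y z = 0 \<or> \<delta> \<le> \<bar>orient x y z\<bar>"
    and T: "T = 3 * ((real (m ^ 3) + 2) * perim * perim)\<^sup>2 / (\<delta> * cr (r - a) (l - a))"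
  shows "real (P_count V a (m ^ 3)) \<le> real m ^ 3 * (2 ^ m * (1 + T) * real (2 * m + 2) ^ (m ^ 2))"
proof -
  have T0: "0 \<le> T" unfolding T using \<delta> cr_pos by (intro divide_nonneg_pos) auto
  have "real (P_count V a (m ^ 3)) \<le> (\<Sum>k<m ^ 3. real (beam_count k s0))"
    using P_count_le[of "m ^ 3"] by (metis of_nat_le_iff of_nat_sum)
  also have "\<dots> \<le> (\<Sum>k<m ^ 3. 2 ^ m * (1 + T) * real (2 * m + 2) ^ (m ^ 2))"
  proof (rule sum_mono)
    fix k assume "k \<in> {..<m ^ 3}"
    then have k: "k \<le> m ^ 3" by simp
    have "k div m \<le> m ^ 3 div m" using k by (rule div_le_mono)
    also have "\<dots> = m ^ 2" using m by (simp add: power3_eq_cube power2_eq_square)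
    finally have "real (2 * m + 2) ^ (k div m) \<le> real (2 * m + 2) ^ (m ^ 2)"
      by (intro power_increasing) auto
    then have "2 ^ m * (1 + T) * real (2 * m + 2) ^ (k div m) \<le> 2 ^ m * (1 + T) * real (2 * m + 2) ^ (m ^ 2)"
      using T0 by (intro mult_left_mono) auto
    then show "real (beam_count k s0) \<le> 2 ^ m * (1 + T) * real (2 * m + 2) ^ (m ^ 2)"
      using beam_count_bound[OF m \<delta> gap T k] by linarith
  qed
  also have "\<dots> = real m ^ 3 * (2 ^ m * (1 + T) * real (2 * m + 2) ^ (m ^ 2))" by simp
  finally show ?thesis .
qed

end

text \<open>All factors are at most \<open>exp (O(m^2 * ln m))\<close>, so any power of
  \<open>m\<close> above 2 wins; \<open>21 / 10\<close> is three times \<open>7 / 10\<close>, the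
  threshold used for the final exponent.\<close>

lemma growth_limit:
  fixes C s :: real
  assumes "0 < C"
  shows "(\<lambda>m. real m ^ 3 * (2 ^ m * (1 + C * (real (m ^ 3) + 2)\<^sup>2 * 256 ^ (m * (16 * m + 8))) *
    real (2 * m + 2) ^ (m ^ 2)) * exp (- (real m powr (21 / 10)))) \<longlonglongrightarrow> 0"
proof -
  have 1: "(2::real) ^ m = exp (real m * ln 2)" for m
    by (simp add: exp_of_nat_mult)
  have 2: "(256::real) ^ (m * (16 * m + 8)) = exp (real m * (16 * real m + 8) * ln 256)" for m
    using exp_of_nat_mult[of "m * (16 * m + 8)" "ln 256 :: real"] by simp
  have 3: "real (2 * m + 2) ^ (m ^ 2) = exp (real m ^ 2 * ln (2 * real m + 2))" for m
    using exp_of_nat_mult[of "m ^ 2" "ln (2 * real m + 2)"] by (simp add: add.commute)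
  show ?thesis
    unfolding 1 2 3 of_nat_power using assms by real_asymp
qed

definition typical :: "complex set \<Rightarrow> bool" where
  "typical V \<longleftrightarrow> (\<forall>\<^sub>F m in sequentially. let P = reflected_pts V m in
     \<forall>u\<in>P. \<forall>v\<in>P. \<forall>w\<in>P. orient u v w = 0 \<or> (1 / 256) ^ (m * (16 * m + 8)) / 8 \<le> \<bar>orient u v w\<bar>)"

lemma (in triangle) liminf_P_count:
  assumes V_typical: "typical V" and s: "7 / 10 \<le> s"
  shows "liminf (\<lambda>n. ereal (real (P_count V a n) * exp (- (real n powr s)))) < \<infinity>"
proof -
  \<comment> \<open>The part of \<open>T\<close> that does not depend on \<open>m\<close>; 24 is the
    3 from thinness times the 8 from the area gap.\<close>
  define C where "C = 24 * (perim * perim)\<^sup>2 / cr (r - a) (l - a)"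
  have C: "0 < C" unfolding C_def using cr_pos perim_pos by simp
  let ?g = "\<lambda>m. real m ^ 3 * (2 ^ m * (1 + C * (real (m ^ 3) + 2)\<^sup>2 * 256 ^ (m * (16 * m + 8))) *
    real (2 * m + 2) ^ (m ^ 2)) * exp (- (real m powr (21 / 10)))"
  let ?f = "\<lambda>n. ereal (real (P_count V a n) * exp (- (real n powr s)))"
  have "\<forall>\<^sub>F m in sequentially. ?g m < 1"
    using order_tendstoD(2)[OF growth_limit[OF C], of 1] by simp
  then have "\<forall>\<^sub>F m in sequentially. (?f \<circ> (\<lambda>m. m ^ 3)) m \<le> 1"
    using V_typical[unfolded typical_def] eventually_gt_at_top[of 0]
  proof eventually_elim
    case (elim m)
    define \<delta> :: real where "\<delta> = (1 / 256) ^ (m * (16 * m + 8)) / 8"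
    have \<delta>: "0 < \<delta>" unfolding \<delta>_def by simp
    have gap: "orient x y z = 0 \<or> \<delta> \<le> \<bar>orient x y z\<bar>"
      if "x \<in> reflected_pts V m" "y \<in> reflected_pts V m" "z \<in> reflected_pts V m" for x y z
      using elim(2) that unfolding Let_def \<delta>_def by blast
    have T: "C * (real (m ^ 3) + 2)\<^sup>2 * 256 ^ (m * (16 * m + 8)) =
       3 * ((real (m ^ 3) + 2) * perim * perim)\<^sup>2 / (\<delta> * cr (r - a) (l - a))"
      unfolding C_def \<delta>_def using cr_pos
      by (simp add: power_one_over power_mult_distrib divide_simps)
    have "real (P_count V a (m ^ 3)) \<le> real m ^ 3 *
        (2 ^ m * (1 + C * (real (m ^ 3) + 2)\<^sup>2 * 256 ^ (m * (16 * m + 8))) * real (2 * m + 2) ^ (m ^ 2))"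
      by (rule P_count_cube_le[OF elim(3) \<delta> gap T])
    then have "real (P_count V a (m ^ 3)) * exp (- (real m powr (21 / 10))) \<le> ?g m"
      by (rule mult_right_mono) simp
    moreover have "real (P_count V a (m ^ 3)) * exp (- (real (m ^ 3) powr s))
        \<le> real (P_count V a (m ^ 3)) * exp (- (real m powr (21 / 10)))"
    proof (rule mult_left_mono)
      have m1: "1 \<le> real m" using elim(3) by simp
      have "real m powr (21 / 10) \<le> real m powr (3 * s)"
        using m1 s by (intro powr_mono) auto
      also have "\<dots> = (real m powr 3) powr s" by (rule powr_powr[symmetric])
      also have "\<dots> = real (m ^ 3) powr s" using m1 by (simp add: powr_numeral)
      finally show "exp (- (real (m ^ 3) powr s)) \<le> exp (- (real m powr (21 / 10)))" by simp
    qed simp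
    ultimately have "real (P_count V a (m ^ 3)) * exp (- (real (m ^ 3) powr s)) \<le> 1"
      using elim(1) by linarith
    then show ?case by (simp only: o_def one_ereal_def ereal_less_eq)
  qed
  then have "liminf (?f \<circ> (\<lambda>m. m ^ 3)) \<le> 1"
    by (intro Liminf_le) auto
  \<comment> \<open>A liminf is bounded by that of any subsequence, here the cubes.\<close>
  moreover have "liminf ?f \<le> liminf (?f \<circ> (\<lambda>m. m ^ 3))"
    by (rule liminf_subseq_mono) (auto intro!: strict_monoI power_strict_mono)
  ultimately have "liminf ?f \<le> 1" by (rule order_trans[rotated])
  then show ?thesis by (rule le_less_trans) simp
qed

lemma (in angles) orient_tri: "0 < orient 0 1 (tri_C \<alpha> \<beta>)"
  using sin_pos unfolding orient_def cr_def tri_C_def by simp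

lemma (in angles) triangle_at_vertex:
  assumes "v \<in> tri_verts \<alpha> \<beta>"
  shows "\<exists>r l. triangle (tri_verts \<alpha> \<beta>) v r l"
proof -
  let ?C = "tri_C \<alpha> \<beta>"
  have "triangle (tri_verts \<alpha> \<beta>) 0 1 ?C" "triangle (tri_verts \<alpha> \<beta>) 1 ?C 0" "triangle (tri_verts \<alpha> \<beta>) ?C 0 1"
    unfolding triangle_def tri_verts_def
    using orient_tri orient_perm(4,5)[of 0 1 ?C] by auto
  then show ?thesis using assms unfolding tri_verts_def by blast
qed

theorem theorem4p1:
  shows "AE ab in lborel.
     (fst ab > 0 \<and> snd ab > 0 \<and> fst ab + snd ab < pi) \<longrightarrow>
     (\<forall>v \<in> tri_verts (fst ab) (snd ab). \<forall>\<epsilon>::real. \<epsilon> > 0 \<longrightarrow>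
        liminf (\<lambda>n::nat. ereal (real (P_count (tri_verts (fst ab) (snd ab)) v n)
                  * exp (- (real n powr (sqrt 3 - 1 + \<epsilon>))))) < \<infinity>)"
  using AE_orient_gap
proof eventually_elim
  case (elim x)
  show ?case
  proof (intro impI ballI allI)
    fix v and \<epsilon> :: real
    assume x: "0 < fst x \<and> 0 < snd x \<and> fst x + snd x < pi"
      and v: "v \<in> tri_verts (fst x) (snd x)" and \<epsilon>: "0 < \<epsilon>"
    interpret angles "fst x" "snd x" using x by unfold_locales auto
    obtain r l where "triangle (tri_verts (fst x) (snd x)) v r l"
      using triangle_at_vertex[OF v] by blast
    moreover have "typical (tri_verts (fst x) (snd x))"
      using elim x unfolding typical_def by blast
    \<comment> \<open>A rational point strictly between the exponent \<open>2/3\<close> that is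
      reached and \<open>sqrt 3 - 1\<close>; the spare room absorbs the logarithm.\<close>
    moreover have "17 / 10 \<le> sqrt 3" by (rule real_le_rsqrt) (simp add: power2_eq_square)
    then have "7 / 10 \<le> sqrt 3 - 1 + \<epsilon>" using \<epsilon> by simp
    ultimately show "liminf (\<lambda>n::nat. ereal (real (P_count (tri_verts (fst x) (snd x)) v n)
        * exp (- (real n powr (sqrt 3 - 1 + \<epsilon>))))) < \<infinity>"
      by (rule triangle.liminf_P_count)
  qed
qed

end
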